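(* Fix $c>0$ and an integer $K\ge1$, and let $p_n=c/n$. For the Threshold exploration algorithm on $n$ vertices (described in the context) let $A_k(t)=|\mathcal{A}_k(t)|$ and define $\alpha^n_k(t)=A_k(\lfloor nt\rfloor)/n$ for $t\in[0,1]$, $0\le k\le K-1$, and $\boldsymbol{\alpha}^n(t)=(\alpha^n_0(t),\dots,\alpha^n_{K-1}(t))$. For $\boldsymbol{\alpha}=(\alpha_0,\dots,\alpha_{K-1})$ write $\alpha_{\le k}=\alpha_0+\dots+\alpha_k$ and $S(\boldsymbol\alpha)=\sum_{r=0}^{K-2}c^r\alpha_{\le K-2}^r/r!$, and define $$\delta_0(\boldsymbol\alpha)=-c\alpha_0e^{-c\alpha_{\le K-1}}S(\boldsymbol\alpha)+e^{-c\alpha_{\le K-1}},$$ $$\delta_k(\boldsymbol\alpha)=c(\alpha_{k-1}-\alpha_k)e^{-c\alpha_{\le K-1}}S(\boldsymbol\alpha)+e^{-c\alpha_{\le K-1}}\frac{c^k\alpha_{\le K-2}^k}{k!},\quad 1\le k\le K-2,$$ $$\delta_{K-1}(\boldsymbol\alpha)=c\alpha_{K-2}e^{-c\alpha_{\le K-1}}S(\boldsymbol\alpha)+e^{-c\alpha_{\le K-1}}\frac{c^{K-1}\alpha_{\le K-2}^{K-1}}{(K-1)!}.$$ Then the integral equations $\alpha_k(t)=\int_0^t\delta_k(\boldsymbol\alpha(s))\,ds$, $0\le k\le K-1$, $t\in[0,1]$, have a unique solution $\boldsymbol\alpha(t)=(\alpha_0(t),\dots,\alpha_{K-1}(t))$,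 and the process $\{\boldsymbol\alpha^n(t)\}_{0\le t\le1}$ converges in distribution (uniformly on $[0,1]$) to the deterministic process $\{\boldsymbol\alpha(t)\}_{0\le t\le1}$. Consequently, if $\mathcal{I}(n)$ is the final active set of the Threshold model on $G(n,c/n)$ and $I(n)=|\mathcal{I}(n)|$, then $I(n)/n\to\sum_{k=0}^{K-1}\alpha_k(1)$ in distribution as $n\to\infty$.
   Context: Empty sums are zero and empty products are one (so for $K=1$, $S\equiv0$, $\alpha_{\le K-2}=0$ and only $\delta_0=e^{-c\alpha_0}$ is present; any term with index $-1$ is zero). $G(n,p_n)$ is the Erdős–Rényi random graph on $[n]$ with independent edge probability $p_n$. Threshold model: given $G(n,p_n)$, set $\mathcal{I}(0)=\varnothing$; at each step $t+1$ a vertex $v$ is chosen uniformly at random among vertices not yet selected, and $\mathcal{I}(t+1)=\mathcal{I}(t)\cup\{v\}$ if the subgraph induced by $\mathcal{I}(t)\cup\{v\}$ has maximum degree $<K$, else $\mathcal{I}(t+1)=\mathcal{I}(t)$. Threshold exploration algorithm: maintain $\mathcal{A}_0(t),\dots,\mathcal{A}_{K-1}(t)$, $\mathcal{B}(t)$, $\mathcal{U}(t)$, initially $\mathcal{A}_k(0)=\mathcal{B}(0)=\varnothing$, $\mathcal{U}(0)=[n]$; $\mathcal{A}(t)=\bigcup_k\mathcal{A}_k(t)$. At step $t+1$, select $v\in\mathcal{U}(t)$ uniformly, remove it from $\mathcal{U}$, and join it to each $u\in\mathcal{A}(t)\cup\mathcal{B}(t)$ independently with probability $p_n$. Let $v_1,\dots,v_r$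 be the vertices of $\mathcal{A}(t)$ joined to $v$, $v_i\in\mathcal{A}_{k_i}(t)$. If $r<K$ and no $v_i\in\mathcal{A}_{K-1}(t)$, put $v$ into $\mathcal{A}_r$ and move each $v_i$ from $\mathcal{A}_{k_i}$ to $\mathcal{A}_{k_i+1}$; otherwise put $v$ into $\mathcal{B}$. Convergence in distribution of processes is understood as uniform convergence over compact sets. *)

theory Defs
  imports "HOL-Analysis.Analysis" "HOL-Probability.Probability"
begin

text \<open>A vector alpha = (alpha_0,...,alpha_{K-1}) is represented as a function nat => real,
only indices below K being relevant.\<close>

definition alpha_le :: "(nat \<Rightarrow> real) \<Rightarrow> nat \<Rightarrow> real" where
  "alpha_le a m = (\<Sum>i<m. a i)"

definition S_fun :: "real \<Rightarrow> nat \<Rightarrow> (nat \<Rightarrow> real) \<Rightarrow> real" where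
  "S_fun c K a = (\<Sum>r<K-1. c ^ r * alpha_le a (K-1) ^ r / fact r)"

definition delta :: "real \<Rightarrow> nat \<Rightarrow> (nat \<Rightarrow> real) \<Rightarrow> nat \<Rightarrow> real" where
  "delta c K a k =
    (let E = exp (- c * alpha_le a K); S = S_fun c K a; b = alpha_le a (K-1) in
     if k = 0 then - c * a 0 * E * S + E
     else if k < K - 1 then c * (a (k-1) - a k) * E * S + E * c ^ k * b ^ k / fact k
     else c * a (K-2) * E * S + E * c ^ (K-1) * b ^ (K-1) / fact (K-1))"

definition is_solution :: "real \<Rightarrow> nat \<Rightarrow> (nat \<Rightarrow> real \<Rightarrow> real) \<Rightarrow> bool" where
  "is_solution c K al \<longleftrightarrow>
     (\<forall>k<K. \<forall>t\<in>{0..1}. ((\<lambda>s. delta c K (\<lambda>i. al i s) k) has_integral al k t) {0..t})"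

datatype status = Unexpl | Act nat | Blk

definition random_subset :: "'a set \<Rightarrow> real \<Rightarrow> 'a set pmf" where
  "random_subset X p = map_pmf (\<lambda>f. {x\<in>X. f x}) (Pi_pmf X False (\<lambda>_. bernoulli_pmf p))"

definition expl_step :: "nat \<Rightarrow> real \<Rightarrow> nat \<Rightarrow> (nat \<Rightarrow> status) \<Rightarrow> (nat \<Rightarrow> status) pmf" where
  "expl_step n p K s =
    (let U = {v\<in>{..<n}. s v = Unexpl} in
     if U = {} then return_pmf s else
     do { v \<leftarrow> pmf_of_set U;
          N \<leftarrow> random_subset {u\<in>{..<n}. s u \<noteq> Unexpl} p;
          let NA = {u\<in>N. \<exists>k. s u = Act k};
          if card NA < K \<and> (\<forall>u\<in>NA. s u \<noteq> Act (K-1))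
          then return_pmf (\<lambda>u. if u = v then Act (card NA)
                                else if u \<in> NA then (case s u of Act k \<Rightarrow> Act (Suc k) | x \<Rightarrow> x)
                                else s u)
          else return_pmf (s(v := Blk)) })"

fun expl_traj :: "nat \<Rightarrow> real \<Rightarrow> nat \<Rightarrow> nat \<Rightarrow> (nat \<Rightarrow> status) \<Rightarrow> (nat \<Rightarrow> status) list pmf" where
  "expl_traj n p K 0 s = return_pmf [s]"
| "expl_traj n p K (Suc m) s =
     do { s' \<leftarrow> expl_step n p K s; map_pmf (Cons s) (expl_traj n p K m s') }"

definition expl_process :: "real \<Rightarrow> nat \<Rightarrow> nat \<Rightarrow> (nat \<Rightarrow> status) list pmf" where
  "expl_process c K n = expl_traj n (c / real n) K n (\<lambda>_. Unexpl)"

definition A_count :: "nat \<Rightarrow> (nat \<Rightarrow> status) \<Rightarrow> nat \<Rightarrow> nat" where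
  "A_count n s k = card {v\<in>{..<n}. s v = Act k}"

definition alpha_n :: "nat \<Rightarrow> (nat \<Rightarrow> status) list \<Rightarrow> nat \<Rightarrow> real \<Rightarrow> real" where
  "alpha_n n xs k t = real (A_count n (xs ! nat \<lfloor>real n * t\<rfloor>) k) / real n"

definition gnp :: "nat \<Rightarrow> real \<Rightarrow> (nat \<times> nat) set pmf" where
  "gnp n p = random_subset {(i,j). i < j \<and> j < n} p"

definition adj :: "(nat \<times> nat) set \<Rightarrow> nat \<Rightarrow> nat \<Rightarrow> bool" where
  "adj E u w \<longleftrightarrow> u \<noteq> w \<and> (min u w, max u w) \<in> E"

definition thr_step :: "nat \<Rightarrow> nat \<Rightarrow> (nat \<times> nat) set \<Rightarrow> nat set \<times> nat set \<Rightarrow> (nat set \<times> nat set) pmf" where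
  "thr_step n K E st =
    (let I = fst st; Sel = snd st; R = {..<n} - Sel in
     if R = {} then return_pmf st else
     do { v \<leftarrow> pmf_of_set R;
          let J = insert v I;
          if (\<forall>u\<in>J. card {w\<in>J. adj E u w} < K)
          then return_pmf (J, insert v Sel)
          else return_pmf (I, insert v Sel) })"

fun thr_iter :: "nat \<Rightarrow> nat \<Rightarrow> (nat \<times> nat) set \<Rightarrow> nat \<Rightarrow> nat set \<times> nat set \<Rightarrow> (nat set \<times> nat set) pmf" where
  "thr_iter n K E 0 st = return_pmf st"
| "thr_iter n K E (Suc m) st = thr_step n K E st \<bind> thr_iter n K E m"

definition threshold_final :: "real \<Rightarrow> nat \<Rightarrow> nat \<Rightarrow> nat set pmf" where
  "threshold_final c K n =
     do { E \<leftarrow> gnp n (c / real n); map_pmf fst (thr_iter n K E n ({}, {})) }"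

end

(* The drift of the counts A_k in one exploration step, given the current state, is an expression in
binomial point probabilities; by the Poisson approximation it equals delta_k(A/n) up to O(1/n). Since
delta is Lipschitz on bounded sets and a step changes each count by at most K, the squared distance
between A/n and the solution of the integral equations, sampled at the times j/n, satisfies
E[D_{j+1} | state] <= (1 + b/n) D_j + g/n^2. Hence a discounted version of D is a nonnegative
supermartingale with initial value O(1/n), and the maximal inequality gives uniform convergence in
probability.

Existence of a solution is obtained for delta composed with a truncation to [-1,1], which is globally
Lipschitz; as A/n lies in [0,1], the convergence itself shows that the truncation is never active.

For the threshold model the edges of G(n,c/n) are revealed only when their second endpoint is selected,
which turns the final active set into that of the exploration process. *)

theory Submission
  imports Defs
begin


text \<open>The law of the change in the counts does not depend on which unexplored vertex is
  selected, and acceptance is decided by the numbers of neighbours in two disjoint sets, the active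
  vertices of level below K - 1 and those of level K - 1. These numbers are independent binomials,
  so the drift is an explicit function of the counts alone.

  The deviation is measured by squares because the random fluctuation of one step is of order 1/n,
  as large as the drift itself. Centred, it enters the expected square only through its own square,
  of order 1/n^2, and n steps accumulate O(1/n).

  The truncation does not make the argument circular: the process is compared with the truncated
  equation, whose right-hand side agrees with \<open>delta\<close> at every state of the process
  whether or not the solution stays in the cube. Uniqueness is obtained separately, since any
  solution is continuous and therefore bounded on [0,1].

  As the limit is deterministic, convergence in distribution for the uniform metric amounts to
  convergence of the largest deviation to 0 in probability, which is the form proved.\<close>

section \<open>Lipschitz estimates for the drift function\<close>

text \<open>Boundedness is part of the notion because a product of Lipschitz functions is Lipschitz
  only where the factors are bounded. One constant serves both purposes, so closure under sums,
  products and exp can be applied mechanically.\<close>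

definition cube_lipschitz :: "nat \<Rightarrow> real \<Rightarrow> ((nat \<Rightarrow> real) \<Rightarrow> real) \<Rightarrow> bool" where
  "cube_lipschitz K R f \<longleftrightarrow> (\<exists>C\<ge>0. \<forall>x y. (\<forall>i<K. \<bar>x i\<bar> \<le> R \<and> \<bar>y i\<bar> \<le> R) \<longrightarrow>
     \<bar>f x\<bar> \<le> C \<and> \<bar>f x - f y\<bar> \<le> C * (\<Sum>i<K. \<bar>x i - y i\<bar>))"

lemma cube_lipschitzI:
  assumes "C \<ge> 0"
    and "\<And>x y. (\<And>i. i < K \<Longrightarrow> \<bar>x i\<bar> \<le> R) \<Longrightarrow> (\<And>i. i < K \<Longrightarrow> \<bar>y i\<bar> \<le> R) \<Longrightarrow>
      \<bar>f x\<bar> \<le> C \<and> \<bar>f x - f y\<bar> \<le> C * (\<Sum>i<K. \<bar>x i - y i\<bar>)"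
  shows "cube_lipschitz K R f"
  unfolding cube_lipschitz_def using assms by meson

lemma cube_lipschitzE:
  assumes "cube_lipschitz K R f"
  obtains C where "C \<ge> 0"
    and "\<And>x. (\<And>i. i < K \<Longrightarrow> \<bar>x i\<bar> \<le> R) \<Longrightarrow> \<bar>f x\<bar> \<le> C"
    and "\<And>x y. (\<And>i. i < K \<Longrightarrow> \<bar>x i\<bar> \<le> R) \<Longrightarrow> (\<And>i. i < K \<Longrightarrow> \<bar>y i\<bar> \<le> R) \<Longrightarrow>
      \<bar>f x - f y\<bar> \<le> C * (\<Sum>i<K. \<bar>x i - y i\<bar>)"
proof -
  obtain C where "C \<ge> 0" "\<forall>x y. (\<forall>i<K. \<bar>x i\<bar> \<le> R \<and> \<bar>y i\<bar> \<le> R) \<longrightarrow>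
     \<bar>f x\<bar> \<le> C \<and> \<bar>f x - f y\<bar> \<le> C * (\<Sum>i<K. \<bar>x i - y i\<bar>)"
    using assms unfolding cube_lipschitz_def by blast
  then show ?thesis by (intro that[of C]) blast+
qed

lemma cube_lipschitz_const: "cube_lipschitz K R (\<lambda>_. d)"
  by (rule cube_lipschitzI[of "\<bar>d\<bar>"]) (auto intro!: mult_nonneg_nonneg sum_nonneg)

lemma cube_lipschitz_coord:
  assumes "i < K" shows "cube_lipschitz K R (\<lambda>x. x i)"
proof (rule cube_lipschitzI[of "1 + \<bar>R\<bar>"])
  fix x y :: "nat \<Rightarrow> real" assume x: "\<And>i. i < K \<Longrightarrow> \<bar>x i\<bar> \<le> R"
  have "\<bar>x i - y i\<bar> \<le> (\<Sum>i<K. \<bar>x i - y i\<bar>)"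
    using assms by (intro member_le_sum) auto
  also have "\<dots> \<le> (1 + \<bar>R\<bar>) * (\<Sum>i<K. \<bar>x i - y i\<bar>)"
    by (simp add: algebra_simps mult_nonneg_nonneg sum_nonneg)
  finally show "\<bar>x i\<bar> \<le> 1 + \<bar>R\<bar> \<and> \<bar>x i - y i\<bar> \<le> (1 + \<bar>R\<bar>) * (\<Sum>i<K. \<bar>x i - y i\<bar>)"
    using x[OF assms] by linarith
qed auto

lemma cube_lipschitz_add:
  assumes "cube_lipschitz K R f" "cube_lipschitz K R g"
  shows "cube_lipschitz K R (\<lambda>x. f x + g x)"
proof -
  obtain C where C: "C \<ge> 0"
    "\<And>x. (\<And>i. i < K \<Longrightarrow> \<bar>x i\<bar> \<le> R) \<Longrightarrow> \<bar>f x\<bar> \<le> C"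
    "\<And>x y. (\<And>i. i < K \<Longrightarrow> \<bar>x i\<bar> \<le> R) \<Longrightarrow> (\<And>i. i < K \<Longrightarrow> \<bar>y i\<bar> \<le> R) \<Longrightarrow>
      \<bar>f x - f y\<bar> \<le> C * (\<Sum>i<K. \<bar>x i - y i\<bar>)" using assms(1) by (rule cube_lipschitzE) (rule that; blast)
  obtain D where D: "D \<ge> 0"
    "\<And>x. (\<And>i. i < K \<Longrightarrow> \<bar>x i\<bar> \<le> R) \<Longrightarrow> \<bar>g x\<bar> \<le> D"
    "\<And>x y. (\<And>i. i < K \<Longrightarrow> \<bar>x i\<bar> \<le> R) \<Longrightarrow> (\<And>i. i < K \<Longrightarrow> \<bar>y i\<bar> \<le> R) \<Longrightarrow>
      \<bar>g x - g y\<bar> \<le> D * (\<Sum>i<K. \<bar>x i - y i\<bar>)" using assms(2) by (rule cube_lipschitzE) (rule that; blast)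
  show ?thesis
  proof (rule cube_lipschitzI[of "C + D"])
    fix x y :: "nat \<Rightarrow> real"
    assume xy: "\<And>i. i < K \<Longrightarrow> \<bar>x i\<bar> \<le> R" "\<And>i. i < K \<Longrightarrow> \<bar>y i\<bar> \<le> R"
    show "\<bar>f x + g x\<bar> \<le> C + D \<and>
        \<bar>f x + g x - (f y + g y)\<bar> \<le> (C + D) * (\<Sum>i<K. \<bar>x i - y i\<bar>)"
      using C(2)[of x, OF xy(1)] D(2)[of x, OF xy(1)] C(3)[of x y, OF xy] D(3)[of x y, OF xy]
      by (auto simp: distrib_right)
  qed (use C D in auto)
qed

lemma cube_lipschitz_mult:
  assumes "cube_lipschitz K R f" "cube_lipschitz K R g"
  shows "cube_lipschitz K R (\<lambda>x. f x * g x)"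
proof -
  obtain C where C: "C \<ge> 0"
    "\<And>x. (\<And>i. i < K \<Longrightarrow> \<bar>x i\<bar> \<le> R) \<Longrightarrow> \<bar>f x\<bar> \<le> C"
    "\<And>x y. (\<And>i. i < K \<Longrightarrow> \<bar>x i\<bar> \<le> R) \<Longrightarrow> (\<And>i. i < K \<Longrightarrow> \<bar>y i\<bar> \<le> R) \<Longrightarrow>
      \<bar>f x - f y\<bar> \<le> C * (\<Sum>i<K. \<bar>x i - y i\<bar>)" using assms(1) by (rule cube_lipschitzE) (rule that; blast)
  obtain D where D: "D \<ge> 0"
    "\<And>x. (\<And>i. i < K \<Longrightarrow> \<bar>x i\<bar> \<le> R) \<Longrightarrow> \<bar>g x\<bar> \<le> D"
    "\<And>x y. (\<And>i. i < K \<Longrightarrow> \<bar>x i\<bar> \<le> R) \<Longrightarrow> (\<And>i. i < K \<Longrightarrow> \<bar>y i\<bar> \<le> R) \<Longrightarrow>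
      \<bar>g x - g y\<bar> \<le> D * (\<Sum>i<K. \<bar>x i - y i\<bar>)" using assms(2) by (rule cube_lipschitzE) (rule that; blast)
  show ?thesis
  proof (rule cube_lipschitzI[of "2 * (C * D)"])
    fix x y :: "nat \<Rightarrow> real"
    assume xy: "\<And>i. i < K \<Longrightarrow> \<bar>x i\<bar> \<le> R" "\<And>i. i < K \<Longrightarrow> \<bar>y i\<bar> \<le> R"
    let ?d = "\<Sum>i<K. \<bar>x i - y i\<bar>"
    have d: "?d \<ge> 0" by (simp add: sum_nonneg)
    have "\<bar>f x * g x\<bar> \<le> C * D"
      unfolding abs_mult by (intro mult_mono C(2) D(2) xy C(1)) auto
    moreover have "C * D \<ge> 0" using C D by simp
    moreover have "f x * g x - f y * g y = f x * (g x - g y) + (f x - f y) * g y"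
      by (simp add: algebra_simps)
    moreover have "\<bar>f x * (g x - g y)\<bar> \<le> C * (D * ?d)"
      unfolding abs_mult by (intro mult_mono C(2) D(3) xy C(1)) auto
    moreover have "\<bar>(f x - f y) * g y\<bar> \<le> (C * ?d) * D"
      unfolding abs_mult by (intro mult_mono C(3) D(2) xy) (use C d in auto)
    ultimately show "\<bar>f x * g x\<bar> \<le> 2 * (C * D) \<and> \<bar>f x * g x - f y * g y\<bar> \<le> 2 * (C * D) * ?d"
      by (smt (verit) mult.commute mult.left_commute distrib_right mult_2)
  qed (use C D in auto)
qed

lemma cube_lipschitz_exp:
  assumes "cube_lipschitz K R f"
  shows "cube_lipschitz K R (\<lambda>x. exp (f x))"
proof -
  obtain C where C: "C \<ge> 0"
    "\<And>x. (\<And>i. i < K \<Longrightarrow> \<bar>x i\<bar> \<le> R) \<Longrightarrow> \<bar>f x\<bar> \<le> C"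
    "\<And>x y. (\<And>i. i < K \<Longrightarrow> \<bar>x i\<bar> \<le> R) \<Longrightarrow> (\<And>i. i < K \<Longrightarrow> \<bar>y i\<bar> \<le> R) \<Longrightarrow>
      \<bar>f x - f y\<bar> \<le> C * (\<Sum>i<K. \<bar>x i - y i\<bar>)" using assms(1) by (rule cube_lipschitzE) (rule that; blast)
  \<comment> \<open>The tangent inequality 1 + x \<le> exp x at x = b - a, multiplied by exp a;
    exchanging a and b then gives the absolute value.\<close>
  have ex: "exp a - exp b \<le> exp C * \<bar>a - b\<bar>" if "\<bar>a\<bar> \<le> C" "\<bar>b\<bar> \<le> C" for a b :: real
  proof -
    have "1 + (b - a) \<le> exp (b - a)" by (rule exp_ge_add_one_self)
    hence "1 - exp (b - a) \<le> a - b" by linarith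
    hence "exp a * (1 - exp (b - a)) \<le> exp a * (a - b)" by (intro mult_left_mono) auto
    also have "\<dots> \<le> exp a * \<bar>a - b\<bar>" by (intro mult_left_mono) auto
    also have "\<dots> \<le> exp C * \<bar>a - b\<bar>" using that by (intro mult_right_mono) auto
    finally show ?thesis by (simp add: algebra_simps flip: exp_add)
  qed
  show ?thesis
  \<comment> \<open>exp C bounds the values and exp C * C the slope; the factor 1 + C covers
    both.\<close>
  proof (rule cube_lipschitzI[of "exp C * (1 + C)"])
    fix x y :: "nat \<Rightarrow> real"
    assume xy: "\<And>i. i < K \<Longrightarrow> \<bar>x i\<bar> \<le> R" "\<And>i. i < K \<Longrightarrow> \<bar>y i\<bar> \<le> R"
    let ?d = "\<Sum>i<K. \<bar>x i - y i\<bar>"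
    have d: "?d \<ge> 0" by (simp add: sum_nonneg)
    have "\<bar>exp (f x) - exp (f y)\<bar> \<le> exp C * \<bar>f x - f y\<bar>"
      using ex[of "f x" "f y"] ex[of "f y" "f x"] C(2)[of x, OF xy(1)] C(2)[of y, OF xy(2)]
      by (simp add: abs_minus_commute)
    also have "\<dots> \<le> exp C * (C * ?d)" using C(3)[of x y, OF xy] by (intro mult_left_mono) auto
    also have "\<dots> \<le> exp C * (1 + C) * ?d" using d by (simp add: algebra_simps)
    finally have "\<bar>exp (f x) - exp (f y)\<bar> \<le> exp C * (1 + C) * ?d" .
    moreover have "\<bar>exp (f x)\<bar> \<le> exp C * (1 + C)"
    proof -
      have "exp (f x) \<le> exp C" using C(2)[of x, OF xy(1)] by simp
      moreover have "exp C * 1 \<le> exp C * (1 + C)" using C(1) by (intro mult_left_mono) auto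
      ultimately show ?thesis unfolding abs_exp_cancel by linarith
    qed
    ultimately show "\<bar>exp (f x)\<bar> \<le> exp C * (1 + C) \<and>
       \<bar>exp (f x) - exp (f y)\<bar> \<le> exp C * (1 + C) * ?d" by simp
  qed (use C in auto)
qed

lemma cube_lipschitz_sum:
  assumes "\<And>j. j \<in> J \<Longrightarrow> cube_lipschitz K R (f j)"
  shows "cube_lipschitz K R (\<lambda>x. \<Sum>j\<in>J. f j x)"
  using assms
  by (induction J rule: infinite_finite_induct) (auto intro: cube_lipschitz_const cube_lipschitz_add)

lemma cube_lipschitz_power:
  assumes "cube_lipschitz K R f" shows "cube_lipschitz K R (\<lambda>x. f x ^ m)"
  by (induction m) (auto intro: cube_lipschitz_const cube_lipschitz_mult assms)

lemma cube_lipschitz_delta: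
  assumes "k < K" shows "cube_lipschitz K R (\<lambda>x. delta c K x k)"
proof -
  have le: "cube_lipschitz K R (\<lambda>x. alpha_le x m)" if "m \<le> K" for m
    unfolding alpha_le_def using that by (auto intro!: cube_lipschitz_sum cube_lipschitz_coord)
  have S: "cube_lipschitz K R (\<lambda>x. S_fun c K x)"
    unfolding S_fun_def divide_inverse
    by (intro cube_lipschitz_sum cube_lipschitz_mult cube_lipschitz_power cube_lipschitz_const le) auto
  have E: "cube_lipschitz K R (\<lambda>x. exp (- c * alpha_le x K))"
    by (intro cube_lipschitz_exp cube_lipschitz_mult cube_lipschitz_const le) auto
  have P: "cube_lipschitz K R (\<lambda>x. exp (- c * alpha_le x K) * c ^ m * alpha_le x (K - 1) ^ m / fact m)" for m
    unfolding divide_inverse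
    by (intro cube_lipschitz_mult cube_lipschitz_power cube_lipschitz_const le E) auto
  have co: "cube_lipschitz K R (\<lambda>x. x i)" if "i < K" for i
    using that by (rule cube_lipschitz_coord)
  consider "k = 0" | "k > 0" "k < K - 1" | "k > 0" "k = K - 1" using assms by linarith
  then show ?thesis
  proof cases
    case 1
    have "cube_lipschitz K R (\<lambda>x. - c * x 0 * exp (- c * alpha_le x K) * S_fun c K x
        + exp (- c * alpha_le x K))"
      by (intro cube_lipschitz_add cube_lipschitz_mult cube_lipschitz_const co E S) (use assms in auto)
    thus ?thesis using 1 by (simp add: delta_def Let_def)
  next
    case 2
    have "cube_lipschitz K R (\<lambda>x. c * (x (k-1) + (-1) * x k) * exp (- c * alpha_le x K) * S_fun c K x
        + exp (- c * alpha_le x K) * c ^ k * alpha_le x (K - 1) ^ k / fact k)"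
      by (intro cube_lipschitz_add cube_lipschitz_mult cube_lipschitz_const co E S P) (use assms in auto)
    thus ?thesis using 2 by (simp add: delta_def Let_def)
  next
    case 3
    have "cube_lipschitz K R (\<lambda>x. c * x (K-2) * exp (- c * alpha_le x K) * S_fun c K x
        + exp (- c * alpha_le x K) * c ^ (K-1) * alpha_le x (K - 1) ^ (K-1) / fact (K-1))"
      by (intro cube_lipschitz_add cube_lipschitz_mult cube_lipschitz_const co E S P) (use assms in auto)
    thus ?thesis using 3 by (simp add: delta_def Let_def)
  qed
qed

lemma delta_lipschitz:
  obtains C where "C \<ge> 0"
    and "\<And>k x. k < K \<Longrightarrow> (\<And>i. i < K \<Longrightarrow> \<bar>x i\<bar> \<le> R) \<Longrightarrow> \<bar>delta c K x k\<bar> \<le> C"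
    and "\<And>k x y. k < K \<Longrightarrow> (\<And>i. i < K \<Longrightarrow> \<bar>x i\<bar> \<le> R) \<Longrightarrow> (\<And>i. i < K \<Longrightarrow> \<bar>y i\<bar> \<le> R) \<Longrightarrow>
      \<bar>delta c K x k - delta c K y k\<bar> \<le> C * (\<Sum>i<K. \<bar>x i - y i\<bar>)"
proof -
  have "\<forall>k\<in>{..<K}. \<exists>C\<ge>0. \<forall>x y. (\<forall>i<K. \<bar>x i\<bar> \<le> R \<and> \<bar>y i\<bar> \<le> R) \<longrightarrow>
     \<bar>delta c K x k\<bar> \<le> C \<and> \<bar>delta c K x k - delta c K y k\<bar> \<le> C * (\<Sum>i<K. \<bar>x i - y i\<bar>)"
    using cube_lipschitz_delta[of _ K R c] unfolding cube_lipschitz_def by auto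
  then obtain D where D: "\<forall>k\<in>{..<K}. D k \<ge> 0 \<and> (\<forall>x y. (\<forall>i<K. \<bar>x i\<bar> \<le> R \<and> \<bar>y i\<bar> \<le> R) \<longrightarrow>
     \<bar>delta c K x k\<bar> \<le> D k \<and> \<bar>delta c K x k - delta c K y k\<bar> \<le> D k * (\<Sum>i<K. \<bar>x i - y i\<bar>))"
    by (rule bchoice[THEN exE])
  have le: "D k \<le> sum D {..<K}" if "k < K" for k
    using D that by (intro member_le_sum) auto
  show ?thesis
  proof (rule that[of "sum D {..<K}"])
    show "sum D {..<K} \<ge> 0" using D by (intro sum_nonneg) auto
  next
    fix k and x :: "nat \<Rightarrow> real" assume k: "k < K" and x: "\<And>i. i < K \<Longrightarrow> \<bar>x i\<bar> \<le> R"
    have "\<bar>delta c K x k\<bar> \<le> D k" using D k x by blast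
    thus "\<bar>delta c K x k\<bar> \<le> sum D {..<K}" using le[OF k] by linarith
  next
    fix k and x y :: "nat \<Rightarrow> real"
    assume k: "k < K" and x: "\<And>i. i < K \<Longrightarrow> \<bar>x i\<bar> \<le> R" and y: "\<And>i. i < K \<Longrightarrow> \<bar>y i\<bar> \<le> R"
    have "\<bar>delta c K x k - delta c K y k\<bar> \<le> D k * (\<Sum>i<K. \<bar>x i - y i\<bar>)" using D k x y by blast
    also have "\<dots> \<le> sum D {..<K} * (\<Sum>i<K. \<bar>x i - y i\<bar>)"
      by (intro mult_right_mono le k sum_nonneg) auto
    finally show "\<bar>delta c K x k - delta c K y k\<bar> \<le> sum D {..<K} * (\<Sum>i<K. \<bar>x i - y i\<bar>)" .
  qed
qed


section \<open>Integral equations with a Lipschitz right-hand side\<close>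

text \<open>The argument of \<open>F\<close> is a whole sequence of which only the first K entries
  are controlled; the Lipschitz bound in these entries replaces continuity for a topology on
  sequences.\<close>

lemma continuous_on_lipschitz_comp:
  fixes F :: "(nat \<Rightarrow> real) \<Rightarrow> real"
  assumes lip: "\<And>x y. x \<in> X \<Longrightarrow> y \<in> X \<Longrightarrow> \<bar>F x - F y\<bar> \<le> L * (\<Sum>i<K. \<bar>x i - y i\<bar>)"
    and cont: "\<And>i. i < K \<Longrightarrow> continuous_on S (u i)"
    and X: "\<And>s. s \<in> S \<Longrightarrow> (\<lambda>i. u i s) \<in> X"
  shows "continuous_on S (\<lambda>s. F (\<lambda>i. u i s))"
  unfolding continuous_on_def
proof
  fix s assume s: "s \<in> S"
  have "((\<lambda>r. L * (\<Sum>i<K. \<bar>u i r - u i s\<bar>)) \<longlongrightarrow> L * (\<Sum>i<K. \<bar>u i s - u i s\<bar>)) (at s within S)"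
    using cont s unfolding continuous_on_def by (intro tendsto_intros) auto
  then have lim: "((\<lambda>r. L * (\<Sum>i<K. \<bar>u i r - u i s\<bar>)) \<longlongrightarrow> 0) (at s within S)" by simp
  have "eventually (\<lambda>r. norm (F (\<lambda>i. u i r) - F (\<lambda>i. u i s)) \<le> L * (\<Sum>i<K. \<bar>u i r - u i s\<bar>))
      (at s within S)"
    unfolding eventually_at_filter real_norm_def
    by (intro always_eventually allI impI lip X s)
  then have "((\<lambda>r. F (\<lambda>i. u i r) - F (\<lambda>i. u i s)) \<longlongrightarrow> 0) (at s within S)"
    using lim by (rule Lim_null_comparison)
  then show "((\<lambda>r. F (\<lambda>i. u i r)) \<longlongrightarrow> F (\<lambda>i. u i s)) (at s within S)"
    by (simp flip: Lim_null)
qed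

lemma has_integral_exp_linear:
  fixes M t :: real
  assumes "M > 0" "t \<ge> 0"
  shows "((\<lambda>s. exp (M * s)) has_integral (exp (M * t) - 1) / M) {0..t}"
proof -
  have "((\<lambda>s. exp (M * s)) has_integral exp (M * t) / M - exp (M * 0) / M) {0..t}"
    using assms
    by (intro fundamental_theorem_of_calculus)
       (auto intro!: derivative_eq_intros simp flip: has_real_derivative_iff_has_vector_derivative)
  then show ?thesis by (simp add: diff_divide_distrib)
qed

text \<open>The fibres over single naturals are open because nat is discrete. Functions on nat
  \<times> real encode families of curves, so that a system of equations has its unknown in a single
  complete space.\<close>

lemma continuous_on_nat_prod:
  fixes f :: "nat \<times> real \<Rightarrow> real"
  assumes "\<And>k. continuous_on UNIV (\<lambda>t. f (k, t))"
  shows "continuous_on UNIV f"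
proof -
  have "continuous_on ({k} \<times> UNIV) f" for k
  proof -
    have "continuous_on ({k} \<times> UNIV) ((\<lambda>t. f (k, t)) \<circ> snd)"
      by (intro continuous_on_compose continuous_on_snd continuous_on_id
            continuous_on_subset[OF assms]) auto
    then show ?thesis by (rule continuous_on_eq) auto
  qed
  then have "continuous_on (\<Union>k\<in>UNIV. {k} \<times> UNIV) f"
    by (intro continuous_on_open_UN open_Times) (auto intro: discrete_topology_class.open_discrete)
  also have "(\<Union>k\<in>UNIV. {k} \<times> UNIV) = (UNIV :: (nat \<times> real) set)" by auto
  finally show ?thesis .
qed

lemma complete_UNIV_bcontfun:
  "uniform_space_class.complete (UNIV :: ('a::topological_space \<Rightarrow>\<^sub>C 'b::complete_space) set)"
proof (rule completeI)
  fix f :: "nat \<Rightarrow> ('a, 'b) bcontfun" assume "Cauchy f"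
  have "\<forall>e>0. \<exists>N. \<forall>m n x. N \<le> m \<and> N \<le> n \<and> True \<longrightarrow>
      dist (apply_bcontfun (f m) x) (apply_bcontfun (f n) x) < e"
  proof (intro allI impI)
    fix e :: real assume "e > 0"
    then obtain N where N: "\<And>m n. N \<le> m \<Longrightarrow> N \<le> n \<Longrightarrow> dist (f m) (f n) < e"
      using \<open>Cauchy f\<close> unfolding Cauchy_def by blast
    show "\<exists>N. \<forall>m n x. N \<le> m \<and> N \<le> n \<and> True \<longrightarrow>
        dist (apply_bcontfun (f m) x) (apply_bcontfun (f n) x) < e"
      by (intro exI[of _ N] allI impI; elim conjE) (rule le_less_trans[OF dist_bounded N])
  qed
  then have "\<exists>g. \<forall>e>0. \<exists>N. \<forall>n x. N \<le> n \<and> True \<longrightarrow> dist (apply_bcontfun (f n) x) (g x) < e"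
    by (rule uniformly_convergent_eq_cauchy[THEN iffD2])
  then obtain g where "\<forall>e>0. \<exists>N. \<forall>n x. N \<le> n \<and> True \<longrightarrow> dist (apply_bcontfun (f n) x) (g x) < e" ..
  then have "uniform_limit UNIV (\<lambda>n. apply_bcontfun (f n)) g sequentially"
    unfolding uniform_limit_sequentially_iff by simp
  then obtain l where "g = apply_bcontfun l" "f \<longlonglongrightarrow> l"
    by (rule uniform_limit_bcontfunE[OF _ sequentially_bot])
  then show "\<exists>l\<in>UNIV. f \<longlonglongrightarrow> l" by blast
qed

text \<open>The Picard operator is a contraction of the bounded continuous functions once the
  unknown is multiplied by \<open>exp (- M t)\<close> with \<open>M\<close> large.\<close>

lemma lipschitz_integral_equation_exists:
  fixes F :: "nat \<Rightarrow> (nat \<Rightarrow> real) \<Rightarrow> real"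
  assumes bound: "\<And>k x. k < K \<Longrightarrow> \<bar>F k x\<bar> \<le> C"
    and lip: "\<And>k x y. k < K \<Longrightarrow> \<bar>F k x - F k y\<bar> \<le> L * (\<Sum>i<K. \<bar>x i - y i\<bar>)"
    and "L \<ge> 0" "C \<ge> 0"
  obtains u :: "nat \<Rightarrow> real \<Rightarrow> real"
  where "\<And>k t. k < K \<Longrightarrow> t \<in> {0..1} \<Longrightarrow> ((\<lambda>s. F k (\<lambda>i. u i s)) has_integral u k t) {0..t}"
proof -
  \<comment> \<open>Changing the weighted unknown by at most d changes the integrand at s by at most
    L * K * d * exp (M * s), whose integral up to t is at most (L * K / M) * d * exp (M * t). This M
    gives L * K / M \<le> 1/2, hence contraction factor 1/2; the + 1 keeps M positive when L * K =
    0.\<close>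
  define M where "M = 2 * L * K + 1"
  have "L * K \<ge> 0" using \<open>L \<ge> 0\<close> by simp
  then have M: "M > 0" "M \<ge> 1" by (auto simp: M_def)
  \<comment> \<open>Bounded continuous functions are taken on all of nat \<times> real, so the upper
    limit of integration is clamped to [0,1]; this keeps the image of the operator bounded and
    changes nothing for t in [0,1].\<close>
  define cl :: "real \<Rightarrow> real" where "cl t = max 0 (min 1 t)" for t
  have cl: "cl t \<in> {0..1}" for t by (auto simp: cl_def)
  define g :: "((nat \<times> real) \<Rightarrow>\<^sub>C real) \<Rightarrow> nat \<Rightarrow> real \<Rightarrow> real"
    where "g w k s = F k (\<lambda>i. exp (M * s) * apply_bcontfun w (i, s))" for w k s
  have contg: "continuous_on A (g w k)" if "k < K" for w k A
    unfolding g_def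
  proof (rule continuous_on_lipschitz_comp[where X = UNIV and F = "F k"
        and u = "\<lambda>i s. exp (M * s) * apply_bcontfun w (i, s)"])
    show "continuous_on A (\<lambda>s. exp (M * s) * apply_bcontfun w (i, s))" for i
      by (intro continuous_intros continuous_on_compose2[OF continuous_on_apply_bcontfun[of UNIV w]]) auto
  qed (use lip that in auto)
  have intg: "g w k integrable_on {a..b}" if "k < K" for w k a b
    using contg[OF that] by (rule integrable_continuous_real)
  define T0 where "T0 w = (\<lambda>(k, t). if k < K then exp (- M * cl t) * integral {0..cl t} (g w k) else 0)" for w
  have T0: "T0 w \<in> bcontfun" for w
  proof (rule bcontfun_normI)
    show "continuous_on UNIV (T0 w)"
    proof (rule continuous_on_nat_prod)
      fix k show "continuous_on UNIV (\<lambda>t. T0 w (k, t))"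
      proof (cases "k < K")
        case True
        have 1: "continuous_on {0..1} (\<lambda>t. integral {0..t} (g w k))"
          by (rule indefinite_integral_continuous_1[OF intg[OF True]])
        have 2: "continuous_on UNIV cl" unfolding cl_def by (intro continuous_intros)
        have "continuous_on UNIV (\<lambda>t. exp (- M * cl t) * integral {0..cl t} (g w k))"
          by (intro continuous_intros 2 continuous_on_compose2[OF 1 2]) (use cl in auto)
        then show ?thesis using True by (simp add: T0_def)
      qed (simp add: T0_def)
    qed
    fix kt :: "nat \<times> real"
    obtain k t where kt: "kt = (k, t)" by fastforce
    show "norm (T0 w kt) \<le> C"
    proof (cases "k < K")
      case True
      have "norm (integral {0..cl t} (g w k)) \<le> C * (cl t - 0)"
        by (intro integral_bound) (use cl contg True bound in \<open>auto simp: g_def\<close>)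
      also have "\<dots> \<le> C * 1" using cl[of t] \<open>C \<ge> 0\<close> by (intro mult_left_mono) auto
      finally have "\<bar>integral {0..cl t} (g w k)\<bar> \<le> C" by simp
      moreover have "exp (- M * cl t) \<le> 1" using M cl[of t] by simp
      ultimately have "exp (- M * cl t) * \<bar>integral {0..cl t} (g w k)\<bar> \<le> 1 * C"
        by (intro mult_mono) auto
      then show ?thesis using True by (simp add: T0_def kt abs_mult)
    qed (use \<open>C \<ge> 0\<close> in \<open>simp add: T0_def kt\<close>)
  qed
  define T where "T w = Bcontfun (T0 w)" for w
  have T: "apply_bcontfun (T w) = T0 w" for w
    unfolding T_def by (rule Bcontfun_inverse[OF T0])
  have contr: "dist (T w) (T w') \<le> 1/2 * dist w w'" for w w'
  proof (rule dist_bound)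
    fix kt :: "nat \<times> real"
    obtain k t where kt: "kt = (k, t)" by fastforce
    define d where "d = dist w w'"
    have d: "d \<ge> 0" by (simp add: d_def)
    show "dist (apply_bcontfun (T w) kt) (apply_bcontfun (T w') kt) \<le> 1/2 * dist w w'"
    proof (cases "k < K")
      case True
      define r where "r = cl t"
      have r: "r \<ge> 0" using cl[of t] by (simp add: r_def)
      have pt: "norm (g w k s - g w' k s) \<le> (L * K * d) * exp (M * s)" for s
      proof -
        have "norm (g w k s - g w' k s)
            \<le> L * (\<Sum>i<K. \<bar>exp (M * s) * apply_bcontfun w (i, s) - exp (M * s) * apply_bcontfun w' (i, s)\<bar>)"
          unfolding g_def real_norm_def by (rule lip[OF True])
        also have "\<dots> \<le> L * (\<Sum>i<K. exp (M * s) * d)"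
        proof (intro mult_left_mono sum_mono \<open>L \<ge> 0\<close>)
          fix i
          have "\<bar>apply_bcontfun w (i, s) - apply_bcontfun w' (i, s)\<bar> \<le> d"
            unfolding d_def using dist_bounded[of w "(i, s)" w'] by (simp add: dist_real_def)
          then have "exp (M * s) * \<bar>apply_bcontfun w (i, s) - apply_bcontfun w' (i, s)\<bar> \<le> exp (M * s) * d"
            by (intro mult_left_mono) auto
          then show "\<bar>exp (M * s) * apply_bcontfun w (i, s) - exp (M * s) * apply_bcontfun w' (i, s)\<bar>
              \<le> exp (M * s) * d"
            by (simp add: abs_mult flip: right_diff_distrib)
        qed
        finally show ?thesis by (simp add: algebra_simps)
      qed
      have E: "((\<lambda>s. (L * K * d) * exp (M * s)) has_integral (L * K * d) * ((exp (M * r) - 1) / M)) {0..r}"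
        by (intro has_integral_mult_right has_integral_exp_linear M r)
      have "norm (integral {0..r} (\<lambda>s. g w k s - g w' k s)) \<le> integral {0..r} (\<lambda>s. (L * K * d) * exp (M * s))"
        by (intro integral_norm_bound_integral integrable_diff intg True pt)
           (use E in \<open>auto simp: integrable_on_def\<close>)
      also have "\<dots> = (L * K * d) * ((exp (M * r) - 1) / M)" using E by (rule integral_unique)
      also have "\<dots> = (L * K / M) * d * (exp (M * r) - 1)" by simp
      also have "\<dots> \<le> (1/2) * d * exp (M * r)"
      proof (intro mult_mono)
        show "L * K / M \<le> 1/2" using M by (simp add: M_def field_simps)
      qed (use \<open>L \<ge> 0\<close> M r d in auto)
      also have "integral {0..r} (\<lambda>s. g w k s - g w' k s) = integral {0..r} (g w k) - integral {0..r} (g w' k)"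
        by (intro integral_diff intg True)
      finally have "exp (- M * r) * \<bar>integral {0..r} (g w k) - integral {0..r} (g w' k)\<bar>
          \<le> exp (- M * r) * ((1/2) * d * exp (M * r))"
        by (intro mult_left_mono) auto
      also have "\<dots> = 1/2 * d" by (simp add: exp_minus field_simps)
      finally show ?thesis using True
        by (simp add: T T0_def kt dist_real_def d_def r_def abs_mult flip: right_diff_distrib)
    qed (simp add: T T0_def kt)
  qed
  have "\<exists>!w. w \<in> UNIV \<and> T w = w"
    by (rule Banach_fix[OF complete_UNIV_bcontfun, of "1/2"]) (use contr in auto)
  then obtain w where w: "T w = w" by blast
  define u where "u k t = exp (M * t) * apply_bcontfun w (k, t)" for k t
  show ?thesis
  proof (rule that[of u])
    fix k and t :: real assume k: "k < K" and t: "t \<in> {0..1}"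
    have "apply_bcontfun w (k, t) = T0 w (k, t)" using T[of w] unfolding w by (rule fun_cong)
    also have "\<dots> = exp (- M * t) * integral {0..t} (g w k)"
      using k t by (simp add: T0_def cl_def)
    finally have "u k t = integral {0..t} (g w k)"
      by (simp add: u_def exp_minus field_simps)
    moreover have "g w k = (\<lambda>s. F k (\<lambda>i. u i s))" by (auto simp: g_def u_def)
    ultimately show "((\<lambda>s. F k (\<lambda>i. u i s)) has_integral u k t) {0..t}"
      using integrable_integral[OF intg[OF k, of w 0 t]] by simp
  qed
qed

text \<open>The weight exp (- M t) from the existence proof again: where the weighted distance
  attains its maximum G, the equations give G \<le> G / 2. The Lipschitz condition is imposed only
  along the two given curves, so that a right-hand side that is merely Lipschitz on bounded sets can
  be used.\<close>

lemma integral_equation_unique: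
  fixes u v f g :: "nat \<Rightarrow> real \<Rightarrow> real"
  assumes u: "\<And>k t. k < K \<Longrightarrow> t \<in> {0..1} \<Longrightarrow> (f k has_integral u k t) {0..t}"
    and v: "\<And>k t. k < K \<Longrightarrow> t \<in> {0..1} \<Longrightarrow> (g k has_integral v k t) {0..t}"
    and cu: "\<And>k. k < K \<Longrightarrow> continuous_on {0..1} (u k)"
    and cv: "\<And>k. k < K \<Longrightarrow> continuous_on {0..1} (v k)"
    and lip: "\<And>k s. k < K \<Longrightarrow> s \<in> {0..1} \<Longrightarrow> \<bar>f k s - g k s\<bar> \<le> L * (\<Sum>i<K. \<bar>u i s - v i s\<bar>)"
    and "L \<ge> 0" "k < K" "t \<in> {0..1}"
  shows "u k t = v k t"
proof -
  define h where "h s = (\<Sum>i<K. \<bar>u i s - v i s\<bar>)" for s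
  define M where "M = 2 * L * K + 1"
  have "L * K \<ge> 0" using \<open>L \<ge> 0\<close> by simp
  then have M: "M > 0" "M \<ge> 1" by (auto simp: M_def)
  have h: "continuous_on {0..1} (\<lambda>s. exp (- M * s) * h s)"
    unfolding h_def by (intro continuous_intros cu cv) auto
  obtain r where r: "r \<in> {0..1}" and max: "\<And>s. s \<in> {0..1} \<Longrightarrow> exp (- M * s) * h s \<le> exp (- M * r) * h r"
    using continuous_attains_sup[OF compact_Icc _ h] by auto
  define G where "G = exp (- M * r) * h r"
  have h0: "h s \<ge> 0" for s by (simp add: h_def sum_nonneg)
  then have G: "G \<ge> 0" by (simp add: G_def)
  have hs: "h s \<le> G * exp (M * s)" if "s \<in> {0..1}" for s
    using max[OF that] by (simp add: G_def exp_minus field_simps)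
  have each: "\<bar>u i r - v i r\<bar> \<le> (L * G) * ((exp (M * r) - 1) / M)" if i: "i < K" for i
  proof -
    have E: "((\<lambda>s. (L * G) * exp (M * s)) has_integral (L * G) * ((exp (M * r) - 1) / M)) {0..r}"
      by (intro has_integral_mult_right has_integral_exp_linear M) (use r in auto)
    have D: "((\<lambda>s. f i s - g i s) has_integral (u i r - v i r)) {0..r}"
      by (intro has_integral_diff u v i r)
    have "norm (integral {0..r} (\<lambda>s. f i s - g i s)) \<le> integral {0..r} (\<lambda>s. (L * G) * exp (M * s))"
    proof (rule integral_norm_bound_integral)
      fix s assume s: "s \<in> {0..r}"
      then have s': "s \<in> {0..1}" using r by auto
      have "\<bar>f i s - g i s\<bar> \<le> L * h s" unfolding h_def by (rule lip[OF i s'])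
      also have "\<dots> \<le> L * (G * exp (M * s))" by (intro mult_left_mono hs s' \<open>L \<ge> 0\<close>)
      finally show "norm (f i s - g i s) \<le> (L * G) * exp (M * s)" by simp
    qed (use D E in \<open>auto simp: integrable_on_def\<close>)
    then show ?thesis unfolding integral_unique[OF D] integral_unique[OF E] real_norm_def .
  qed
  have "h r \<le> (\<Sum>i<K. (L * G) * ((exp (M * r) - 1) / M))"
    unfolding h_def by (intro sum_mono each) auto
  also have "\<dots> = (L * K / M) * G * (exp (M * r) - 1)" by simp
  also have "\<dots> \<le> (1/2) * G * exp (M * r)"
  proof (intro mult_mono)
    show "L * K / M \<le> 1/2" using M by (simp add: M_def field_simps)
  qed (use \<open>L \<ge> 0\<close> M r G in auto)
  finally have "exp (- M * r) * h r \<le> exp (- M * r) * ((1/2) * G * exp (M * r))"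
    by (intro mult_left_mono) auto
  also have "\<dots> = G / 2" by (simp add: exp_minus field_simps)
  finally have "G \<le> G / 2" unfolding G_def[symmetric] .
  then have "G \<le> 0" by simp
  then have "h t \<le> 0" using hs[OF \<open>t \<in> {0..1}\<close>] G by simp
  moreover have "\<bar>u k t - v k t\<bar> \<le> h t"
    unfolding h_def using \<open>k < K\<close> by (intro member_le_sum) auto
  ultimately show ?thesis by simp
qed

text \<open>Continuity is not built into \<open>is_solution\<close>; it comes from each component
  being an indefinite integral.\<close>

lemma is_solution_continuous:
  assumes "is_solution c K al" "k < K"
  shows "continuous_on {0..1} (al k)"
proof -
  have I: "((\<lambda>s. delta c K (\<lambda>i. al i s) k) has_integral al k t) {0..t}" if "t \<in> {0..1}" for t
    using assms that unfolding is_solution_def by blast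
  have "(\<lambda>s. delta c K (\<lambda>i. al i s) k) integrable_on {0..1}"
    using I[of 1] by (auto simp: integrable_on_def)
  then have "continuous_on {0..1} (\<lambda>t. integral {0..t} (\<lambda>s. delta c K (\<lambda>i. al i s) k))"
    by (rule indefinite_integral_continuous_1)
  then show ?thesis by (rule continuous_on_eq) (use I in \<open>auto intro: integral_unique\<close>)
qed

text \<open>Two solutions are continuous, so both stay in a common cube, on which
  \<open>delta\<close> is Lipschitz. Thus uniqueness holds among all solutions, not only among those
  with values in [0,1].\<close>

lemma is_solution_unique:
  assumes "is_solution c K al" "is_solution c K be" "k < K" "t \<in> {0..1}"
  shows "al k t = be k t"
proof -
  have bd: "\<exists>R. \<forall>k<K. \<forall>s\<in>{0..1}. \<bar>a k s\<bar> \<le> R" if a: "is_solution c K a" for a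
  proof -
    have "\<exists>R. \<forall>s\<in>{0..1}. \<bar>a k s\<bar> \<le> R" if "k < K" for k
      using compact_imp_bounded[OF compact_continuous_image[OF is_solution_continuous[OF a that] compact_Icc]]
      unfolding bounded_iff by auto
    then obtain R where R: "\<And>k s. k < K \<Longrightarrow> s \<in> {0..1} \<Longrightarrow> \<bar>a k s\<bar> \<le> R k" by metis
    have "\<bar>a k s\<bar> \<le> (\<Sum>j<K. \<bar>R j\<bar>)" if "k < K" "s \<in> {0..1}" for k s
    proof -
      have "\<bar>a k s\<bar> \<le> \<bar>R k\<bar>" using R[OF that] by linarith
      also have "\<dots> \<le> (\<Sum>j<K. \<bar>R j\<bar>)" using that by (intro member_le_sum) auto
      finally show ?thesis .
    qed
    then show ?thesis by blast
  qed
  obtain R1 where R1: "\<And>k s. k < K \<Longrightarrow> s \<in> {0..1} \<Longrightarrow> \<bar>al k s\<bar> \<le> R1" using bd[OF assms(1)] by blast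
  obtain R2 where R2: "\<And>k s. k < K \<Longrightarrow> s \<in> {0..1} \<Longrightarrow> \<bar>be k s\<bar> \<le> R2" using bd[OF assms(2)] by blast
  define R where "R = max R1 R2"
  obtain C where C: "C \<ge> 0"
    "\<And>k x y. k < K \<Longrightarrow> (\<And>i. i < K \<Longrightarrow> \<bar>x i\<bar> \<le> R) \<Longrightarrow> (\<And>i. i < K \<Longrightarrow> \<bar>y i\<bar> \<le> R) \<Longrightarrow>
      \<bar>delta c K x k - delta c K y k\<bar> \<le> C * (\<Sum>i<K. \<bar>x i - y i\<bar>)"
    by (rule delta_lipschitz[of K R c]) (rule that; blast)
  show ?thesis
  proof (rule integral_equation_unique[where u = al and v = be and L = C and K = K])
    show "((\<lambda>s. delta c K (\<lambda>i. al i s) k) has_integral al k t) {0..t}" if "k < K" "t \<in> {0..1}" for k t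
      using assms that unfolding is_solution_def by blast
    show "((\<lambda>s. delta c K (\<lambda>i. be i s) k) has_integral be k t) {0..t}" if "k < K" "t \<in> {0..1}" for k t
      using assms that unfolding is_solution_def by blast
    show "\<bar>delta c K (\<lambda>i. al i s) k - delta c K (\<lambda>i. be i s) k\<bar> \<le> C * (\<Sum>i<K. \<bar>al i s - be i s\<bar>)"
      if "k < K" "s \<in> {0..1}" for k s
    proof (rule C(2)[OF that(1)])
      fix i assume "i < K"
      show "\<bar>al i s\<bar> \<le> R" using R1[OF \<open>i < K\<close> that(2)] by (simp add: R_def)
      show "\<bar>be i s\<bar> \<le> R" using R2[OF \<open>i < K\<close> that(2)] by (simp add: R_def)
    qed
  qed (use is_solution_continuous assms C in auto)
qed

definition clamp1 :: "real \<Rightarrow> real" where "clamp1 x = max (-1) (min 1 x)"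

lemma clamp1_bounds: "\<bar>clamp1 x\<bar> \<le> 1" by (auto simp: clamp1_def)

lemma clamp1_id: "\<bar>x\<bar> \<le> 1 \<Longrightarrow> clamp1 x = x" by (auto simp: clamp1_def)

lemma clamp1_lipschitz: "\<bar>clamp1 x - clamp1 y\<bar> \<le> \<bar>x - y\<bar>" by (auto simp: clamp1_def)

definition delta1 :: "real \<Rightarrow> nat \<Rightarrow> (nat \<Rightarrow> real) \<Rightarrow> nat \<Rightarrow> real" where
  "delta1 c K x k = delta c K (\<lambda>i. clamp1 (x i)) k"

text \<open>The truncation maps into the cube of radius 1 and does not increase distances, so the
  estimates for \<open>delta\<close> on that cube become global.\<close>

lemma delta1_lipschitz:
  obtains C where "C \<ge> 0"
    and "\<And>k x. k < K \<Longrightarrow> \<bar>delta1 c K x k\<bar> \<le> C"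
    and "\<And>k x y. k < K \<Longrightarrow> \<bar>delta1 c K x k - delta1 c K y k\<bar> \<le> C * (\<Sum>i<K. \<bar>x i - y i\<bar>)"
proof -
  obtain C where C: "C \<ge> 0"
    "\<And>k x. k < K \<Longrightarrow> (\<And>i. i < K \<Longrightarrow> \<bar>x i\<bar> \<le> 1) \<Longrightarrow> \<bar>delta c K x k\<bar> \<le> C"
    "\<And>k x y. k < K \<Longrightarrow> (\<And>i. i < K \<Longrightarrow> \<bar>x i\<bar> \<le> 1) \<Longrightarrow> (\<And>i. i < K \<Longrightarrow> \<bar>y i\<bar> \<le> 1) \<Longrightarrow>
      \<bar>delta c K x k - delta c K y k\<bar> \<le> C * (\<Sum>i<K. \<bar>x i - y i\<bar>)"
    by (rule delta_lipschitz[of K 1 c]) (rule that; blast)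
  show ?thesis
  proof (rule that[OF C(1)])
    show "\<bar>delta1 c K x k\<bar> \<le> C" if "k < K" for k x
      unfolding delta1_def by (rule C(2)[OF that]) (rule clamp1_bounds)
    fix k and x y :: "nat \<Rightarrow> real" assume k: "k < K"
    have "\<bar>delta1 c K x k - delta1 c K y k\<bar> \<le> C * (\<Sum>i<K. \<bar>clamp1 (x i) - clamp1 (y i)\<bar>)"
      unfolding delta1_def by (rule C(3)[OF k]) (rule clamp1_bounds)+
    also have "\<dots> \<le> C * (\<Sum>i<K. \<bar>x i - y i\<bar>)"
      by (intro mult_left_mono sum_mono clamp1_lipschitz C)
    finally show "\<bar>delta1 c K x k - delta1 c K y k\<bar> \<le> C * (\<Sum>i<K. \<bar>x i - y i\<bar>)" .
  qed
qed


section \<open>Independence in random subsets\<close>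

lemma random_subset_Un:
  assumes "finite A" "finite B" "A \<inter> B = {}"
  shows "random_subset (A \<union> B) p = map_pmf (\<lambda>(a, b). a \<union> b) (pair_pmf (random_subset A p) (random_subset B p))"
proof -
  have "(case x of (f, g) \<Rightarrow> {x \<in> A \<union> B. if x \<in> A then f x else g x})
      = (case map_prod (\<lambda>f. {x\<in>A. f x}) (\<lambda>f. {x\<in>B. f x}) x of (a, b) \<Rightarrow> a \<union> b)" for x
    using assms(3) by (auto split: prod.split)
  then show ?thesis
    unfolding random_subset_def Pi_pmf_union[OF assms]
    by (simp add: pmf.map_comp o_def case_prod_unfold flip: map_pair)
qed

lemma set_random_subset:
  assumes "finite X" shows "set_pmf (random_subset X p) \<subseteq> Pow X"
  by (auto simp: random_subset_def)

lemma finite_set_random_subset: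
  assumes "finite X" shows "finite (set_pmf (random_subset X p))"
  using finite_subset[OF set_random_subset[OF assms]] assms by auto

text \<open>Used to identify a random set of neighbours of a vertex with the corresponding random
  set of edges. The induction adds one element at a time, where the claim is about a single
  Bernoulli variable.\<close>

lemma random_subset_image:
  assumes "finite X" "inj_on h X"
  shows "random_subset (h ` X) p = map_pmf ((`) h) (random_subset X p)"
  using assms
proof (induction X rule: finite_induct)
  case empty
  then show ?case by (simp add: random_subset_def)
next
  case (insert x X)
  have single: "random_subset {y} p = map_pmf (\<lambda>b. if b then {y} else {}) (bernoulli_pmf p)" for y :: 'c
    unfolding random_subset_def Pi_pmf_singleton pmf.map_comp
    by (intro map_pmf_cong) auto
  have single': "random_subset {y} p = map_pmf (\<lambda>b. if b then {y} else {}) (bernoulli_pmf p)" for y :: 'b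
    unfolding random_subset_def Pi_pmf_singleton pmf.map_comp
    by (intro map_pmf_cong) auto
  have "random_subset (h ` insert x X) p = random_subset ({h x} \<union> h ` X) p" by simp
  also have "\<dots> = map_pmf (\<lambda>(a, b). a \<union> b) (pair_pmf (random_subset {h x} p) (random_subset (h ` X) p))"
    using insert by (intro random_subset_Un) auto
  also have "\<dots> = map_pmf (\<lambda>(a, b). a \<union> b)
      (pair_pmf (map_pmf ((`) h) (random_subset {x} p)) (map_pmf ((`) h) (random_subset X p)))"
    using insert by (simp add: single single' pmf.map_comp o_def if_distrib cong: if_cong)
  also have "\<dots> = map_pmf ((`) h) (map_pmf (\<lambda>(a, b). a \<union> b) (pair_pmf (random_subset {x} p) (random_subset X p)))"
    by (simp add: pmf.map_comp o_def case_prod_unfold image_Un flip: map_pair)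
  also have "\<dots> = map_pmf ((`) h) (random_subset ({x} \<union> X) p)"
    using insert by (subst random_subset_Un[symmetric]) auto
  finally show ?case by simp
qed

lemma prob_random_subset_indep:
  assumes "finite A" "finite B" "A \<inter> B = {}"
  shows "measure_pmf.prob (random_subset (A \<union> B) p) {N. P (N \<inter> A) \<and> Q (N \<inter> B)}
    = measure_pmf.prob (random_subset A p) {N. P N} * measure_pmf.prob (random_subset B p) {N. Q N}"
proof -
  let ?A = "random_subset A p" and ?B = "random_subset B p"
  have "measure_pmf.prob (random_subset (A \<union> B) p) {N. P (N \<inter> A) \<and> Q (N \<inter> B)}
      = measure_pmf.prob (pair_pmf ?A ?B) {(a, b). P ((a \<union> b) \<inter> A) \<and> Q ((a \<union> b) \<inter> B)}"
    unfolding random_subset_Un[OF assms] measure_map_pmf by (auto intro!: arg_cong[where f = "measure_pmf.prob _"])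
  \<comment> \<open>The product formula is applied to countable events, and the predicates may hold
    for uncountably many sets; intersecting with the finite supports settles this and also gives (a
    \<union> b) \<inter> A = a.\<close>
  also have "\<dots> = measure_pmf.prob (pair_pmf ?A ?B) (({N. P N} \<inter> set_pmf ?A) \<times> ({N. Q N} \<inter> set_pmf ?B))"
  proof -
    have "(a \<union> b) \<inter> A = a" "(a \<union> b) \<inter> B = b" if "a \<in> set_pmf ?A" "b \<in> set_pmf ?B" for a b
      using that set_random_subset[OF assms(1)] set_random_subset[OF assms(2)] assms(3) by blast+
    then have "{(a, b). P ((a \<union> b) \<inter> A) \<and> Q ((a \<union> b) \<inter> B)} \<inter> set_pmf (pair_pmf ?A ?B)
        = ({N. P N} \<inter> set_pmf ?A) \<times> ({N. Q N} \<inter> set_pmf ?B)" by auto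
    from arg_cong[OF this, of "measure_pmf.prob (pair_pmf ?A ?B)"] show ?thesis
      unfolding measure_Int_set_pmf .
  qed
  also have "\<dots> = measure_pmf.prob ?A ({N. P N} \<inter> set_pmf ?A) * measure_pmf.prob ?B ({N. Q N} \<inter> set_pmf ?B)"
    using assms by (intro measure_pmf_prob_product countable_finite finite_Int finite_set_random_subset disjI2)
  finally show ?thesis by (simp add: measure_Int_set_pmf)
qed

lemma prob_random_subset_Int:
  assumes "finite X" "Y \<subseteq> X"
  shows "measure_pmf.prob (random_subset X p) {N. P (N \<inter> Y)} = measure_pmf.prob (random_subset Y p) {N. P N}"
proof -
  have X: "X = Y \<union> (X - Y)" using assms by auto
  have "measure_pmf.prob (random_subset X p) {N. P (N \<inter> Y)}
     = measure_pmf.prob (random_subset (Y \<union> (X - Y)) p) {N. P (N \<inter> Y) \<and> True}"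
    using X by simp
  also have "\<dots> = measure_pmf.prob (random_subset Y p) {N. P N}"
    using assms by (subst prob_random_subset_indep) (auto intro: finite_subset)
  finally show ?thesis .
qed

lemma map_card_random_subset:
  assumes "finite X" "p \<in> {0..1}"
  shows "map_pmf card (random_subset X p) = binomial_pmf (card X) p"
  unfolding random_subset_def pmf.map_comp o_def
  by (rule binomial_pmf_altdef'[symmetric]) (use assms in auto)

lemma prob_random_subset_card:
  assumes "finite X" "p \<in> {0..1}"
  shows "measure_pmf.prob (random_subset X p) {N. Q (card N)}
    = measure_pmf.prob (binomial_pmf (card X) p) {j. Q j}"
  unfolding map_card_random_subset[OF assms, symmetric] measure_map_pmf by (simp add: vimage_def)

lemma prob_random_subset_singleton:
  assumes "p \<in> {0..1}"
  shows "measure_pmf.prob (random_subset {x} p) {N. x \<in> N} = p"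
proof -
  have "measure_pmf.prob (random_subset {x} p) {N. x \<in> N} = measure_pmf.prob (bernoulli_pmf p) {True}"
    unfolding random_subset_def Pi_pmf_singleton measure_map_pmf
    by (rule arg_cong[where f = "measure_pmf.prob _"]) auto
  then show ?thesis using assms by (simp add: measure_pmf_single)
qed

section \<open>Poisson approximation of binomial probabilities\<close>

definition pois :: "nat \<Rightarrow> real \<Rightarrow> real" where
  "pois j x = exp (- x) * x ^ j / fact j"

lemma pois_nonneg: "x \<ge> 0 \<Longrightarrow> pois j x \<ge> 0"
  by (simp add: pois_def)

lemma pois_le_1:
  assumes "x \<ge> 0" shows "pois j x \<le> 1"
proof -
  have "(\<Sum>n\<in>{j}. x ^ n /\<^sub>R fact n) \<le> (\<Sum>n. x ^ n /\<^sub>R fact n)"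
    by (rule sum_le_suminf[OF summable_exp_generic]) (use assms in auto)
  then have "x ^ j / fact j \<le> exp x" by (simp add: exp_def field_simps)
  then have "exp (- x) * (x ^ j / fact j) \<le> exp (- x) * exp x" by (intro mult_left_mono) auto
  then show ?thesis by (simp add: pois_def flip: exp_add)
qed

text \<open>Shifting the index by two makes room for the terms of index -1 and -2, which are zero, in the
  derivatives.\<close>

definition shifted_pois :: "nat \<Rightarrow> real \<Rightarrow> real" where
  "shifted_pois i x = (if i < 2 then 0 else pois (i - 2) x)"

lemma DERIV_shifted_pois: "(shifted_pois (Suc i) has_real_derivative shifted_pois i x - shifted_pois (Suc i) x) (at x)"
proof -
  consider "i = 0" | "i = 1" | j where "i = Suc (Suc j)" by (metis One_nat_def not0_implies_Suc)
  then show ?thesis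
  proof cases
    case 1 then show ?thesis by (simp add: shifted_pois_def[abs_def])
  next
    case 2
    have "(pois 0 has_real_derivative - pois 0 x) (at x)"
      unfolding pois_def[abs_def] by (auto intro!: derivative_eq_intros)
    then show ?thesis using 2 by (simp add: shifted_pois_def[abs_def])
  next
    case (3 j)
    have "((\<lambda>x. exp (- x) * x ^ Suc j / fact (Suc j)) has_real_derivative
        (- exp (- x) * x ^ Suc j + exp (- x) * (real (Suc j) * x ^ j)) / fact (Suc j)) (at x)"
      by (rule derivative_eq_intros refl | simp)+
    moreover have "(- exp (- x) * x ^ Suc j + exp (- x) * (real (Suc j) * x ^ j)) / fact (Suc j) = pois j x - pois (Suc j) x"
      unfolding pois_def by (simp add: divide_simps)
    ultimately have "(pois (Suc j) has_real_derivative pois j x - pois (Suc j) x) (at x)"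
      unfolding pois_def[of "Suc j", abs_def] by (simp add: pois_def)
    then show ?thesis using 3 by (simp add: shifted_pois_def[abs_def])
  qed
qed

text \<open>The derivative of the j-th Poisson weight is the weight at j - 1 minus the weight at j,
  so the first-order Taylor polynomial at l is exactly the recursion for one additional Bernoulli
  trial with parameter p. The second derivative is a combination of weights in [0,1], which makes
  the remainder of order p^2.\<close>

lemma pois_taylor:
  assumes "l \<ge> 0" "p \<ge> 0"
  shows "\<bar>pois j (l + p) - ((1 - p) * pois j l + p * (case j of 0 \<Rightarrow> 0 | Suc i \<Rightarrow> pois i l))\<bar> \<le> 2 * p\<^sup>2"
proof (cases "p = 0")
  case False
  define d where "d m = (if m = 0 then shifted_pois (j+2) else if m = 1 then (\<lambda>x. shifted_pois (j+1) x - shifted_pois (j+2) x)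
     else (\<lambda>x. shifted_pois j x - 2 * shifted_pois (j+1) x + shifted_pois (j+2) x))" for m :: nat
  have "\<exists>t>l. t < l + p \<and> shifted_pois (j+2) (l+p) = (\<Sum>m<2. d m l / fact m * (l + p - l) ^ m) + d 2 t / fact 2 * (l + p - l) ^ 2"
  proof (rule Taylor_up[where a = l])
    show "\<forall>m t. m < 2 \<and> l \<le> t \<and> t \<le> l + p \<longrightarrow> (d m has_real_derivative d (Suc m) t) (at t)"
    proof (intro allI impI)
      fix m :: nat and t assume m: "m < 2 \<and> l \<le> t \<and> t \<le> l + p"
      show "(d m has_real_derivative d (Suc m) t) (at t)"
      proof (cases "m = 0")
        case True
        then show ?thesis using DERIV_shifted_pois[of "j+1" t] by (simp add: d_def)
      next
        case False
        then have "m = 1" using m by auto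
        have "((\<lambda>x. shifted_pois (Suc j) x - shifted_pois (Suc (j+1)) x) has_real_derivative
            (shifted_pois j t - shifted_pois (Suc j) t) - (shifted_pois (j+1) t - shifted_pois (Suc (j+1)) t)) (at t)"
          by (intro DERIV_diff DERIV_shifted_pois)
        then show ?thesis using \<open>m = 1\<close> by (simp add: d_def algebra_simps)
      qed
    qed
  qed (use assms False in \<open>auto simp: d_def\<close>)
  then obtain t where t: "t > l" and
    eq: "shifted_pois (j+2) (l+p) = (\<Sum>m<2. d m l / fact m * (l + p - l) ^ m) + d 2 t / fact 2 * (l + p - l) ^ 2" by blast
  have q: "0 \<le> shifted_pois i t \<and> shifted_pois i t \<le> 1" for i
    using t assms pois_nonneg[of t] pois_le_1[of t] by (auto simp: shifted_pois_def)
  have "pois j (l + p) = pois j l + p * (shifted_pois (j+1) l - pois j l) + p\<^sup>2 * (d 2 t / 2)"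
    using eq by (simp add: numeral_2_eq_2 d_def shifted_pois_def algebra_simps)
  moreover have "shifted_pois (j+1) l = (case j of 0 \<Rightarrow> 0 | Suc i \<Rightarrow> pois i l)"
    by (auto simp: shifted_pois_def split: nat.split)
  moreover have "\<bar>p\<^sup>2 * (d 2 t / 2)\<bar> \<le> p\<^sup>2 * 2"
    unfolding abs_mult using q[of j] q[of "j+1"] q[of "j+2"] by (intro mult_mono) (auto simp: d_def)
  ultimately show ?thesis by (simp add: algebra_simps)
qed auto

lemma pmf_binomial_Suc:
  assumes "p \<in> {0..1}"
  shows "pmf (binomial_pmf (Suc B) p) j = (1 - p) * pmf (binomial_pmf B p) j
    + p * (case j of 0 \<Rightarrow> 0 | Suc i \<Rightarrow> pmf (binomial_pmf B p) i)"
proof -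
  have "binomial_pmf (Suc B) p = bernoulli_pmf p \<bind> (\<lambda>b. map_pmf ((+) (if b then 1 else 0)) (binomial_pmf B p))"
    unfolding binomial_pmf_Suc[OF assms] by (simp add: map_pmf_def)
  moreover have zero: "((+) 0) = (\<lambda>x::nat. x)" by auto
  ultimately have "pmf (binomial_pmf (Suc B) p) j
      = p * pmf (map_pmf Suc (binomial_pmf B p)) j + (1 - p) * pmf (map_pmf (\<lambda>x. x) (binomial_pmf B p)) j"
    using assms by (simp add: pmf_bind plus_1_eq_Suc[unfolded One_nat_def] zero algebra_simps del: pmf_binomial)
  moreover have "pmf (map_pmf Suc (binomial_pmf B p)) j = (case j of 0 \<Rightarrow> 0 | Suc i \<Rightarrow> pmf (binomial_pmf B p) i)"
    by (auto split: nat.split simp: pmf_map_inj' pmf_eq_0_set_pmf)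
  ultimately show ?thesis by simp
qed

text \<open>Poisson weights satisfy the recursion of the binomial weights up to 2 * p^2 per trial.
  The recursion is a convex combination, so the error already present is not amplified and the
  contributions add up. For p = c/n and B \<le> n the total is O(1/n).\<close>

lemma binomial_poisson_approx:
  assumes "p \<in> {0..1}"
  shows "\<bar>pmf (binomial_pmf B p) j - pois j (p * B)\<bar> \<le> 2 * p\<^sup>2 * B"
proof (induction B arbitrary: j)
  case 0
  then show ?case using assms by (auto simp: binomial_pmf_0 pois_def power_0_left indicator_def)
next
  case (Suc B)
  let ?b = "\<lambda>j. pmf (binomial_pmf B p) j" and ?q = "\<lambda>j. pois j (p * B)"
  let ?s = "\<lambda>f j. case j of 0 \<Rightarrow> (0::real) | Suc i \<Rightarrow> f i"
  have IH: "\<bar>?b j - ?q j\<bar> \<le> 2 * p\<^sup>2 * B" for j by (rule Suc.IH)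
  have IH': "\<bar>?s ?b j - ?s ?q j\<bar> \<le> 2 * p\<^sup>2 * B" using IH by (auto split: nat.split)
  have T: "\<bar>pois j (p * B + p) - ((1 - p) * ?q j + p * ?s ?q j)\<bar> \<le> 2 * p\<^sup>2"
    by (rule pois_taylor) (use assms in auto)
  have "\<bar>(1 - p) * (?b j - ?q j) + p * (?s ?b j - ?s ?q j)\<bar>
      \<le> \<bar>(1 - p) * (?b j - ?q j)\<bar> + \<bar>p * (?s ?b j - ?s ?q j)\<bar>" by (rule abs_triangle_ineq)
  also have "\<dots> \<le> (1 - p) * (2 * p\<^sup>2 * B) + p * (2 * p\<^sup>2 * B)"
    unfolding abs_mult using assms IH[of j] IH' by (intro add_mono mult_mono) auto
  also have "\<dots> = 2 * p\<^sup>2 * B" by (simp add: algebra_simps)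
  finally have "\<bar>(1 - p) * (?b j - ?q j) + p * (?s ?b j - ?s ?q j)\<bar> \<le> 2 * p\<^sup>2 * B" .
  moreover have "pmf (binomial_pmf (Suc B) p) j - pois j (p * Suc B)
     = (1 - p) * (?b j - ?q j) + p * (?s ?b j - ?s ?q j)
       - (pois j (p * B + p) - ((1 - p) * ?q j + p * ?s ?q j))"
    unfolding pmf_binomial_Suc[OF assms] by (simp add: algebra_simps del: pmf_binomial)
  moreover have "2 * p\<^sup>2 * Suc B = 2 * p\<^sup>2 * B + 2 * p\<^sup>2" by (simp add: algebra_simps)
  ultimately show ?case using T by linarith
qed

text \<open>Serves the case in which one low vertex is already known to be a neighbour and only the
  others are counted: dropping a trial costs at most p. For B = 0 the subtraction gives 0 and no
  trial is dropped.\<close>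

lemma binomial_pred_approx:
  assumes "p \<in> {0..1}"
  shows "\<bar>pmf (binomial_pmf (B - 1) p) j - pois j (p * B)\<bar> \<le> 2 * p\<^sup>2 * B + p"
proof (cases B)
  case 0
  then show ?thesis using binomial_poisson_approx[OF assms, of 0 j] assms by auto
next
  case (Suc A)
  have "0 \<le> (case j of 0 \<Rightarrow> (0::real) | Suc i \<Rightarrow> pmf (binomial_pmf A p) i)"
    "(case j of 0 \<Rightarrow> (0::real) | Suc i \<Rightarrow> pmf (binomial_pmf A p) i) \<le> 1"
    by (auto split: nat.split simp: pmf_le_1)
  then have "\<bar>(case j of 0 \<Rightarrow> 0 | Suc i \<Rightarrow> pmf (binomial_pmf A p) i) - pmf (binomial_pmf A p) j\<bar> \<le> 1"
    using pmf_le_1[of "binomial_pmf A p" j] pmf_nonneg[of "binomial_pmf A p" j] by linarith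
  then have "\<bar>p * ((case j of 0 \<Rightarrow> (0::real) | Suc i \<Rightarrow> pmf (binomial_pmf A p) i) - pmf (binomial_pmf A p) j)\<bar> \<le> p * 1"
    unfolding abs_mult using assms by (intro mult_mono) auto
  then have "\<bar>pmf (binomial_pmf (Suc A) p) j - pmf (binomial_pmf A p) j\<bar> \<le> p"
    unfolding pmf_binomial_Suc[OF assms] by (simp add: algebra_simps del: pmf_binomial)
  then show ?thesis using binomial_poisson_approx[OF assms, of B j] Suc by (simp del: pmf_binomial)
qed


section \<open>The drift of one exploration step\<close>

definition explored :: "nat \<Rightarrow> (nat \<Rightarrow> status) \<Rightarrow> nat set" where
  "explored n s = {u\<in>{..<n}. s u \<noteq> Unexpl}"

definition level :: "nat \<Rightarrow> (nat \<Rightarrow> status) \<Rightarrow> nat \<Rightarrow> nat set" where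
  "level n s k = {v\<in>{..<n}. s v = Act k}"

text \<open>The active vertices that can still receive a neighbour. The cardinality divided by n is
  the quantity \<alpha> with index \<le> K - 2, which the code writes as
  \<open>alpha_le x (K-1)\<close>.\<close>

definition low :: "nat \<Rightarrow> nat \<Rightarrow> (nat \<Rightarrow> status) \<Rightarrow> nat set" where
  "low n K s = (\<Union>k<K-1. level n s k)"

definition valid :: "nat \<Rightarrow> nat \<Rightarrow> (nat \<Rightarrow> status) \<Rightarrow> bool" where
  "valid n K s \<longleftrightarrow> (\<forall>v<n. \<forall>k. s v = Act k \<longrightarrow> k < K)"

definition accepts :: "nat \<Rightarrow> (nat \<Rightarrow> status) \<Rightarrow> nat set \<Rightarrow> bool" where
  "accepts K s N \<longleftrightarrow> card {u\<in>N. \<exists>k. s u = Act k} < K \<and> (\<forall>u\<in>{u\<in>N. \<exists>k. s u = Act k}. s u \<noteq> Act (K-1))"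

text \<open>The deterministic part of \<open>expl_step\<close>: once the vertex and its neighbour
  set are drawn, the new state is a function of them.\<close>

definition place :: "nat \<Rightarrow> (nat \<Rightarrow> status) \<Rightarrow> nat \<Rightarrow> nat set \<Rightarrow> nat \<Rightarrow> status" where
  "place K s v N =
    (if accepts K s N
     then (\<lambda>u. if u = v then Act (card {u\<in>N. \<exists>k. s u = Act k})
               else if u \<in> {u\<in>N. \<exists>k. s u = Act k} then (case s u of Act k \<Rightarrow> Act (Suc k) | x \<Rightarrow> x)
               else s u)
     else s(v := Blk))"

lemma expl_step_eq:
  assumes "{v\<in>{..<n}. s v = Unexpl} \<noteq> {}"
  shows "expl_step n p K s = pmf_of_set {v\<in>{..<n}. s v = Unexpl} \<bind>
    (\<lambda>v. map_pmf (place K s v) (random_subset (explored n s) p))"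
  unfolding expl_step_def Let_def map_pmf_def place_def accepts_def explored_def if_distrib[of return_pmf]
  by (simp only: if_not_P[OF assms])

lemma finite_levels [simp, intro]:
  "finite (explored n s)" "finite (level n s k)" "finite (low n K s)"
  by (auto simp: explored_def level_def low_def)

lemma A_count_eq: "A_count n s k = card (level n s k)"
  by (simp add: A_count_def level_def)

text \<open>Reduces acceptance to two cardinalities. The sets involved are disjoint, so for a random
  \<open>N\<close> these are independent binomial variables.\<close>

lemma accepts_iff:
  assumes "valid n K s" "N \<subseteq> explored n s" "K \<ge> 1"
  shows "accepts K s N \<longleftrightarrow> card (N \<inter> low n K s) < K \<and> card (N \<inter> level n s (K-1)) = 0"
    and "card (N \<inter> level n s (K-1)) = 0 \<Longrightarrow> {u\<in>N. \<exists>k. s u = Act k} = N \<inter> low n K s"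
proof -
  have act: "{u\<in>N. \<exists>k. s u = Act k} = (N \<inter> low n K s) \<union> (N \<inter> level n s (K-1))"
  proof (intro equalityI subsetI)
    fix u assume u: "u \<in> {u\<in>N. \<exists>k. s u = Act k}"
    then obtain k where k: "s u = Act k" "u \<in> N" by auto
    then have un: "u < n" using assms by (auto simp: explored_def)
    then have "k < K" using assms(1) k by (auto simp: valid_def)
    then have "k < K - 1 \<or> k = K - 1" by linarith
    then show "u \<in> (N \<inter> low n K s) \<union> (N \<inter> level n s (K-1))"
      using k un by (auto simp: low_def level_def)
  qed (auto simp: low_def level_def)
  have fin: "finite (N \<inter> level n s (K-1))" by auto
  have H: "(\<forall>u\<in>{u\<in>N. \<exists>k. s u = Act k}. s u \<noteq> Act (K-1)) \<longleftrightarrow> card (N \<inter> level n s (K-1)) = 0"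
    using assms(2) unfolding card_0_eq[OF fin] by (auto simp: level_def explored_def)
  show eq: "card (N \<inter> level n s (K-1)) = 0 \<Longrightarrow> {u\<in>N. \<exists>k. s u = Act k} = N \<inter> low n K s"
    unfolding act card_0_eq[OF fin] by blast
  show "accepts K s N \<longleftrightarrow> card (N \<inter> low n K s) < K \<and> card (N \<inter> level n s (K-1)) = 0"
    unfolding accepts_def H using eq by auto
qed

text \<open>The terms are the new vertex arriving at level k, neighbours promoted from level k - 1,
  and neighbours promoted away from level k. The case k = 0 is separated because 0 - 1 = 0 on the
  naturals would count level 0 as its own source.\<close>

definition count_change :: "nat \<Rightarrow> nat \<Rightarrow> (nat \<Rightarrow> status) \<Rightarrow> nat \<Rightarrow> nat set \<Rightarrow> real" where
  "count_change n K s k N =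
     of_bool (accepts K s N \<and> card (N \<inter> low n K s) = k)
     + (if k = 0 then 0 else of_bool (accepts K s N) * real (card (N \<inter> level n s (k-1))))
     - of_bool (accepts K s N) * real (card (N \<inter> level n s k))"

lemma A_count_place:
  assumes "valid n K s" "N \<subseteq> explored n s" "K \<ge> 1" "v < n" "s v = Unexpl"
  shows "real (A_count n (place K s v N) k) = real (A_count n s k) + count_change n K s k N"
proof (cases "accepts K s N")
  case False
  then have "level n (place K s v N) k = level n s k"
    using assms by (auto simp: level_def place_def)
  then show ?thesis using False by (simp add: A_count_eq count_change_def)
next
  case True
  then have NA: "{u\<in>N. \<exists>k. s u = Act k} = N \<inter> low n K s"
    using accepts_iff[OF assms(1-3)] by auto
  let ?L = "level n s"
  let ?V = "if card (N \<inter> low n K s) = k then {v} else {}"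
  let ?P = "if k = 0 then {} else N \<inter> ?L (k - 1)"
  have vN: "v \<notin> N" using assms by (auto simp: explored_def)
  have vL: "v \<notin> ?L i" for i using assms by (auto simp: level_def)
  have pl: "place K s v N u = (if u = v then Act (card (N \<inter> low n K s))
     else if u \<in> N \<and> (\<exists>k. s u = Act k) then (case s u of Act k \<Rightarrow> Act (Suc k) | x \<Rightarrow> x) else s u)" for u
    using True unfolding place_def NA by (auto simp: NA[symmetric])
  have "level n (place K s v N) k = (?L k - N) \<union> ?P \<union> ?V"
  proof (rule set_eqI)
    fix u
    show "u \<in> level n (place K s v N) k \<longleftrightarrow> u \<in> (?L k - N) \<union> ?P \<union> ?V"
      using assms(2,4,5) vN unfolding level_def pl
      by (cases "u = v"; cases "u \<in> N"; cases "s u") (auto simp: explored_def)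
  qed
  moreover have "card ((?L k - N) \<union> ?P \<union> ?V) = card ((?L k - N) \<union> ?P) + card ?V"
    using vN vL by (intro card_Un_disjoint) auto
  moreover have "card ((?L k - N) \<union> ?P) = card (?L k - N) + card ?P"
    by (intro card_Un_disjoint) (auto simp: level_def)
  moreover have "real (card (?L k - N)) = real (card (?L k)) - real (card (N \<inter> ?L k))"
    by (subst Int_commute, subst card_Diff_subset_Int) (auto intro!: of_nat_diff card_mono)
  ultimately show ?thesis using True
    by (simp add: A_count_eq count_change_def)
qed

lemma level_subset_low: "k < K - 1 \<Longrightarrow> level n s k \<subseteq> low n K s"
  by (auto simp: low_def)

text \<open>An accepted vertex has fewer than K active neighbours, so a level gains at most K - 1
  promoted vertices and the new vertex, and loses at most K - 1.\<close>

lemma count_change_bound: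
  assumes "valid n K s" "N \<subseteq> explored n s" "K \<ge> 1" "k < K"
  shows "\<bar>count_change n K s k N\<bar> \<le> real K"
proof (cases "accepts K s N")
  case True
  then have lt: "card (N \<inter> low n K s) < K" "card (N \<inter> level n s (K-1)) = 0"
    using accepts_iff[OF assms(1-3)] by auto
  have le: "card (N \<inter> level n s i) \<le> card (N \<inter> low n K s)" if "i < K" for i
  proof (cases "i = K - 1")
    case False
    then have "i < K - 1" using that by simp
    from level_subset_low[OF this, of n s] show ?thesis by (intro card_mono) auto
  qed (use lt in auto)
  have "card (N \<inter> level n s (k-1)) \<le> card (N \<inter> low n K s)" "card (N \<inter> level n s k) \<le> card (N \<inter> low n K s)"
    using assms by (intro le; simp)+
  then show ?thesis using True lt by (auto simp: count_change_def)
qed (simp add: count_change_def)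

lemma expectation_of_bool:
  "measure_pmf.expectation M (\<lambda>x. of_bool (P x)) = measure_pmf.prob M {x. P x}"
proof -
  have "(\<lambda>x. of_bool (P x)) = (indicator {x. P x} :: 'a \<Rightarrow> real)" by (auto simp: indicator_def)
  then show ?thesis by simp
qed

text \<open>For k < K the equation on the number of low neighbours already implies the degree
  condition, so the event splits into one about \<open>L\<close> and one about
  \<open>H\<close>.\<close>

lemma prob_accept_card:
  assumes "valid n K s" "K \<ge> 1" "k < K" "p \<in> {0..1}"
  defines "L \<equiv> low n K s" and "H \<equiv> level n s (K-1)"
  shows "measure_pmf.prob (random_subset (explored n s) p) {N. accepts K s N \<and> card (N \<inter> L) = k}
    = pmf (binomial_pmf (card L) p) k * pmf (binomial_pmf (card H) p) 0"
proof -
  let ?X = "explored n s"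
  have fin: "finite L" "finite H" and disj: "L \<inter> H = {}" and sub: "L \<union> H \<subseteq> ?X"
    by (auto simp: L_def H_def low_def level_def explored_def)
  have "measure_pmf.prob (random_subset ?X p) {N. accepts K s N \<and> card (N \<inter> L) = k}
      = measure_pmf.prob (random_subset ?X p) {N. card (N \<inter> (L \<union> H) \<inter> L) = k \<and> card (N \<inter> (L \<union> H) \<inter> H) = 0}"
  proof (rule measure_pmf.finite_measure_eq_AE)
    have "N \<in> {N. accepts K s N \<and> card (N \<inter> L) = k} \<longleftrightarrow>
        N \<in> {N. card (N \<inter> (L \<union> H) \<inter> L) = k \<and> card (N \<inter> (L \<union> H) \<inter> H) = 0}" if "N \<subseteq> ?X" for N
    proof -
      have "N \<inter> (L \<union> H) \<inter> L = N \<inter> L" "N \<inter> (L \<union> H) \<inter> H = N \<inter> H" by auto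
      then show ?thesis
        using accepts_iff(1)[OF assms(1) that assms(2)] assms(3) by (auto simp: L_def H_def)
    qed
    then show "AE N in random_subset ?X p. N \<in> {N. accepts K s N \<and> card (N \<inter> L) = k} \<longleftrightarrow>
        N \<in> {N. card (N \<inter> (L \<union> H) \<inter> L) = k \<and> card (N \<inter> (L \<union> H) \<inter> H) = 0}"
      unfolding AE_measure_pmf_iff using set_random_subset[of ?X p] by blast
  qed auto
  also have "\<dots> = measure_pmf.prob (random_subset (L \<union> H) p) {N. card (N \<inter> L) = k \<and> card (N \<inter> H) = 0}"
    by (rule prob_random_subset_Int) (use sub in auto)
  also have "\<dots> = measure_pmf.prob (random_subset L p) {N. card N = k} * measure_pmf.prob (random_subset H p) {N. card N = 0}"
    by (rule prob_random_subset_indep) (use fin disj in auto)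
  also have "\<dots> = pmf (binomial_pmf (card L) p) k * pmf (binomial_pmf (card H) p) 0"
    using prob_random_subset_card[OF fin(1) assms(4), of "\<lambda>j. j = k"]
      prob_random_subset_card[OF fin(2) assms(4), of "\<lambda>j. j = 0"]
    by (simp only: singleton_conv measure_pmf_single)
  finally show ?thesis .
qed

text \<open>A neighbour \<open>u\<close> takes one of the K - 1 places available, so fewer than K -
  1 of the other card L - 1 low vertices may be neighbours. The three disjoint groups {u}, L - {u}
  and H contribute independent factors.\<close>

lemma prob_accept_neighbour:
  assumes "valid n K s" "K \<ge> 1" "p \<in> {0..1}"
  defines "L \<equiv> low n K s" and "H \<equiv> level n s (K-1)"
  assumes "u \<in> L"
  shows "measure_pmf.prob (random_subset (explored n s) p) {N. accepts K s N \<and> u \<in> N}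
    = p * ((\<Sum>j<K-1. pmf (binomial_pmf (card L - 1) p) j) * pmf (binomial_pmf (card H) p) 0)"
proof -
  let ?X = "explored n s" and ?L = "L - {u}"
  let ?Y = "?L \<union> H"
  have fin: "finite L" "finite H" and disj: "L \<inter> H = {}" and sub: "L \<union> H \<subseteq> ?X"
    by (auto simp: L_def H_def low_def level_def explored_def)
  have "measure_pmf.prob (random_subset ?X p) {N. accepts K s N \<and> u \<in> N}
      = measure_pmf.prob (random_subset ?X p) {N. u \<in> N \<inter> ({u} \<union> ?Y) \<inter> {u} \<and>
           (card (N \<inter> ({u} \<union> ?Y) \<inter> ?Y \<inter> ?L) < K - 1 \<and> card (N \<inter> ({u} \<union> ?Y) \<inter> ?Y \<inter> H) = 0)}" (is "_ = measure_pmf.prob _ ?E")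
  proof (rule measure_pmf.finite_measure_eq_AE)
    have "N \<in> {N. accepts K s N \<and> u \<in> N} \<longleftrightarrow> N \<in> ?E" if "N \<subseteq> ?X" for N
    proof (cases "u \<in> N")
      case True
      have e: "N \<inter> ({u} \<union> ?Y) \<inter> ?Y \<inter> ?L = N \<inter> ?L" "N \<inter> ({u} \<union> ?Y) \<inter> ?Y \<inter> H = N \<inter> H"
        using disj by auto
      have "N \<inter> L = insert u (N \<inter> ?L)" using True \<open>u \<in> L\<close> by auto
      then have c: "card (N \<inter> L) = Suc (card (N \<inter> ?L))" using fin by simp
      have "accepts K s N \<longleftrightarrow> card (N \<inter> ?L) < K - 1 \<and> card (N \<inter> H) = 0"
        using accepts_iff(1)[OF assms(1) that assms(2)] unfolding L_def[symmetric] H_def[symmetric] c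
        by (simp add: less_diff_conv)
      then show ?thesis using True unfolding mem_Collect_eq e by blast
    qed auto
    then show "AE N in random_subset ?X p. N \<in> {N. accepts K s N \<and> u \<in> N} \<longleftrightarrow> N \<in> ?E"
      unfolding AE_measure_pmf_iff using set_random_subset[of ?X p] by blast
  qed auto
  also have "\<dots> = measure_pmf.prob (random_subset ({u} \<union> ?Y) p) {N. u \<in> N \<inter> {u} \<and>
           (card (N \<inter> ?Y \<inter> ?L) < K - 1 \<and> card (N \<inter> ?Y \<inter> H) = 0)}"
    by (rule prob_random_subset_Int) (use sub \<open>u \<in> L\<close> in auto)
  also have "\<dots> = measure_pmf.prob (random_subset {u} p) {N. u \<in> N} *
      measure_pmf.prob (random_subset ?Y p) {N. card (N \<inter> ?L) < K - 1 \<and> card (N \<inter> H) = 0}"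
    by (rule prob_random_subset_indep) (use fin disj \<open>u \<in> L\<close> in auto)
  also have "measure_pmf.prob (random_subset ?Y p) {N. card (N \<inter> ?L) < K - 1 \<and> card (N \<inter> H) = 0}
     = measure_pmf.prob (random_subset ?L p) {N. card N < K - 1} * measure_pmf.prob (random_subset H p) {N. card N = 0}"
    by (rule prob_random_subset_indep) (use fin disj in auto)
  also have "measure_pmf.prob (random_subset ?L p) {N. card N < K - 1} = measure_pmf.prob (binomial_pmf (card L - 1) p) {..<K-1}"
    using prob_random_subset_card[of ?L p "\<lambda>j. j < K - 1"] fin assms(3) \<open>u \<in> L\<close>
    by (simp add: lessThan_def del: pmf_binomial)
  also have "\<dots> = (\<Sum>j<K-1. pmf (binomial_pmf (card L - 1) p) j)"
    by (rule measure_measure_pmf_finite) simp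
  also have "measure_pmf.prob (random_subset H p) {N. card N = 0} = pmf (binomial_pmf (card H) p) 0"
    using prob_random_subset_card[OF fin(2) assms(3), of "\<lambda>j. j = 0"]
    by (simp only: singleton_conv measure_pmf_single)
  finally show ?thesis using prob_random_subset_singleton[OF assms(3), of u] by simp
qed

text \<open>\<open>r\<close> is the probability that a given low vertex is joined to an accepted
  vertex, the same for all low vertices. Nothing leaves level K - 1, because a neighbour there
  forces rejection.\<close>

definition mean_change :: "nat \<Rightarrow> nat \<Rightarrow> real \<Rightarrow> (nat \<Rightarrow> status) \<Rightarrow> nat \<Rightarrow> real" where
  "mean_change n K p s k =
    (let l = card (low n K s); h = card (level n s (K-1));
         r = p * ((\<Sum>j<K-1. pmf (binomial_pmf (l - 1) p) j) * pmf (binomial_pmf h p) 0)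
     in pmf (binomial_pmf l p) k * pmf (binomial_pmf h p) 0
        + (if k = 0 then 0 else A_count n s (k-1) * r)
        - (if k < K - 1 then A_count n s k * r else 0))"

text \<open>By linearity: the number of neighbours in a level is a sum of indicators over its
  vertices, which reduces the promotion terms to the probability for a single vertex.\<close>

lemma expectation_count_change:
  assumes "valid n K s" "K \<ge> 1" "k < K" "p \<in> {0..1}"
  shows "measure_pmf.expectation (random_subset (explored n s) p) (count_change n K s k) = mean_change n K p s k"
proof -
  let ?R = "random_subset (explored n s) p"
  have int: "integrable (measure_pmf ?R) f" for f :: "nat set \<Rightarrow> real"
    by (intro integrable_measure_pmf_finite finite_set_random_subset) simp
  have card_eq: "real (card (N \<inter> M)) = (\<Sum>u\<in>M. of_bool (u \<in> N))" if "finite M" for N M :: "nat set"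
    using that by (simp add: of_bool_def sum.If_cases Int_commute)
  have lev: "measure_pmf.expectation ?R (\<lambda>N. of_bool (accepts K s N) * real (card (N \<inter> level n s i)))
     = A_count n s i * (p * ((\<Sum>j<K-1. pmf (binomial_pmf (card (low n K s) - 1) p) j) * pmf (binomial_pmf (card (level n s (K-1))) p) 0))"
    if "i < K - 1" for i
  proof -
    have "(\<lambda>N. of_bool (accepts K s N) * real (card (N \<inter> level n s i)))
        = (\<lambda>N. \<Sum>u\<in>level n s i. of_bool (accepts K s N \<and> u \<in> N))"
      by (auto simp: card_eq sum_distrib_left of_bool_conj)
    then have "measure_pmf.expectation ?R (\<lambda>N. of_bool (accepts K s N) * real (card (N \<inter> level n s i)))
      = (\<Sum>u\<in>level n s i. measure_pmf.prob ?R {N. accepts K s N \<and> u \<in> N})"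
      by (simp only: Bochner_Integration.integral_sum[OF int] expectation_of_bool)
    also have "\<dots> = (\<Sum>u\<in>level n s i. p * ((\<Sum>j<K-1. pmf (binomial_pmf (card (low n K s) - 1) p) j) * pmf (binomial_pmf (card (level n s (K-1))) p) 0))"
      using level_subset_low[OF that, of n s] by (intro sum.cong refl prob_accept_neighbour assms) auto
    finally show ?thesis by (simp add: A_count_eq)
  qed
  have top: "measure_pmf.expectation ?R (\<lambda>N. of_bool (accepts K s N) * real (card (N \<inter> level n s (K-1)))) = 0"
  proof -
    have "measure_pmf.expectation ?R (\<lambda>N. of_bool (accepts K s N) * real (card (N \<inter> level n s (K-1))))
      = measure_pmf.expectation ?R (\<lambda>_. 0)"
    proof (intro integral_cong_AE)
      show "AE N in ?R. of_bool (accepts K s N) * real (card (N \<inter> level n s (K-1))) = 0"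
        unfolding AE_measure_pmf_iff
        using accepts_iff(1)[OF assms(1) _ assms(2)] set_random_subset[of "explored n s" p] by auto
    qed auto
    then show ?thesis by simp
  qed
  have "measure_pmf.expectation ?R (count_change n K s k) =
      measure_pmf.expectation ?R (\<lambda>N. of_bool (accepts K s N \<and> card (N \<inter> low n K s) = k))
      + (if k = 0 then 0 else measure_pmf.expectation ?R (\<lambda>N. of_bool (accepts K s N) * real (card (N \<inter> level n s (k-1)))))
      - measure_pmf.expectation ?R (\<lambda>N. of_bool (accepts K s N) * real (card (N \<inter> level n s k)))"
    unfolding count_change_def[abs_def]
    by (cases "k = 0") (simp_all only: Bochner_Integration.integral_add[OF int int]
        Bochner_Integration.integral_diff[OF int int] if_True if_False simp_thms Bochner_Integration.integral_zero)
  also have "\<dots> = mean_change n K p s k"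
  proof (cases "k < K - 1")
    case True
    then show ?thesis
      unfolding expectation_of_bool prob_accept_card[OF assms] mean_change_def Let_def
      using lev[of k] lev[of "k-1"] by auto
  next
    case False
    then have k: "k = K - 1" using assms by auto
    have "k > 0 \<Longrightarrow> k - 1 < K - 1" using k by auto
    then show ?thesis
      unfolding expectation_of_bool prob_accept_card[OF assms] mean_change_def Let_def
      using lev[of "k-1"] top k by auto
  qed
  finally show ?thesis .
qed

text \<open>The exponential of - c times the sum of all \<alpha> factors into a part for the low
  vertices and a part for level K - 1. Hence \<open>delta\<close> has the form of
  \<open>mean_change\<close> with binomial weights replaced by Poisson weights, and the two can be
  compared term by term.\<close>

lemma delta_pois:
  assumes "k < K"
  shows "delta c K x k = pois k (c * alpha_le x (K-1)) * pois 0 (c * x (K-1))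
    + (if k = 0 then 0 else c * x (k-1) * (\<Sum>j<K-1. pois j (c * alpha_le x (K-1)) * pois 0 (c * x (K-1))))
    - (if k < K - 1 then c * x k * (\<Sum>j<K-1. pois j (c * alpha_le x (K-1)) * pois 0 (c * x (K-1))) else 0)"
proof -
  define b where "b = alpha_le x (K-1)"
  define E where "E = exp (- c * alpha_le x K)"
  have "alpha_le x K = b + x (K-1)"
    using assms unfolding alpha_le_def b_def by (cases K) auto
  then have E: "exp (- (c * b)) * exp (- (c * x (K-1))) = E"
    unfolding E_def by (simp add: algebra_simps flip: exp_add)
  have P: "pois j (c * b) * pois 0 (c * x (K-1)) = E * c ^ j * b ^ j / fact j" for j
    unfolding E[symmetric] pois_def by (simp add: power_mult_distrib)
  have S: "(\<Sum>j<K-1. E * c ^ j * b ^ j / fact j) = E * S_fun c K x"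
    unfolding S_fun_def b_def[symmetric] by (simp add: sum_distrib_left mult.assoc)
  consider "k = 0" "K = 1" | "k = 0" "K > 1" | "k > 0" "k < K - 1" | "k > 0" "k = K - 1"
    using assms by linarith
  then show ?thesis
    unfolding b_def[symmetric] P S delta_def Let_def E_def[symmetric]
    by cases (simp_all add: S_fun_def algebra_simps numeral_2_eq_2)
qed

text \<open>Origin of the constant: (2 * c^2 + c) / n bounds the error of any single binomial
  weight, with or without the dropped trial. A product of two weights doubles it. Each of the two
  promotion terms sums at most K such products and carries a factor at most c, which gives 2 + 2 *
  (2 * c * K). The condition c \<le> n makes c/n a probability.\<close>

lemma mean_change_delta:
  assumes "valid n K s" "K \<ge> 1" "k < K" "c > 0" "c \<le> real n" "n > 0"
  shows "\<bar>mean_change n K (c / n) s k - delta c K (\<lambda>i. A_count n s i / n) k\<bar> \<le> ((2 + 4 * c * K) * (2 * c\<^sup>2 + c)) / n"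
proof -
  define p where "p = c / n"
  have p: "p \<in> {0..1}" using assms by (simp add: p_def)
  define x where "x i = A_count n s i / n" for i
  define l where "l = card (low n K s)"
  define h where "h = card (level n s (K-1))"
  define \<eta> where "\<eta> = 2 * p\<^sup>2 * n + p"
  have \<eta>: "\<eta> = (2 * c\<^sup>2 + c) / n" using assms by (simp add: \<eta>_def p_def power2_eq_square field_simps)
  have sub: "card M \<le> n" if "M \<subseteq> {..<n}" for M using card_mono[OF _ that] by simp
  have l: "l \<le> n" and h: "h \<le> n" and A: "A_count n s i \<le> n" for i
    unfolding l_def h_def A_count_eq by (auto intro!: sub simp: low_def level_def)
  have "l = (\<Sum>i<K-1. card (level n s i))"
    unfolding l_def low_def by (rule card_UN_disjoint) (auto simp: level_def)
  then have pl: "c * alpha_le x (K-1) = p * l"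
    by (simp add: alpha_le_def x_def p_def A_count_eq sum_distrib_left sum_divide_distrib)
  have ph: "c * x (K-1) = p * h" by (simp add: x_def p_def h_def A_count_eq)
  have px: "c * x i = A_count n s i * p" for i by (simp add: x_def p_def)
  have "2 * p\<^sup>2 * m \<le> 2 * p\<^sup>2 * n" if "m \<le> n" for m using that by (intro mult_left_mono) auto
  then have e: "2 * p\<^sup>2 * m \<le> \<eta>" "2 * p\<^sup>2 * m + p \<le> \<eta>" if "m \<le> n" for m
    using that p by (auto simp: \<eta>_def add_increasing2)
  have b1: "\<bar>pmf (binomial_pmf l p) j - pois j (p * l)\<bar> \<le> \<eta>" for j
    using binomial_poisson_approx[OF p] e(1)[OF l] by (rule order_trans)
  have b2: "\<bar>pmf (binomial_pmf (l - 1) p) j - pois j (p * l)\<bar> \<le> \<eta>" for j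
    using binomial_pred_approx[OF p] e(2)[OF l] by (rule order_trans)
  have b3: "\<bar>pmf (binomial_pmf h p) 0 - pois 0 (p * h)\<bar> \<le> \<eta>"
    using binomial_poisson_approx[OF p] e(1)[OF h] by (rule order_trans)
  have prod: "\<bar>a * b - a' * b'\<bar> \<le> 2 * \<eta>" if "\<bar>a - a'\<bar> \<le> \<eta>" "\<bar>b - b'\<bar> \<le> \<eta>" "0 \<le> b" "b \<le> 1" "0 \<le> a'" "a' \<le> 1" for a b a' b' :: real
  proof -
    have "a * b - a' * b' = (a - a') * b + a' * (b - b')" by (simp add: algebra_simps)
    moreover have "\<bar>(a - a') * b\<bar> \<le> \<eta> * 1" unfolding abs_mult using that by (intro mult_mono) auto
    moreover have "\<bar>a' * (b - b')\<bar> \<le> 1 * \<eta>" unfolding abs_mult using that by (intro mult_mono) auto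
    ultimately show ?thesis by linarith
  qed
  have pos: "p * l \<ge> 0" using p by simp
  have d1: "\<bar>pmf (binomial_pmf l p) j * pmf (binomial_pmf h p) 0 - pois j (p * l) * pois 0 (p * h)\<bar> \<le> 2 * \<eta>" for j
    by (rule prod[OF b1 b3 pmf_nonneg pmf_le_1 pois_nonneg[OF pos] pois_le_1[OF pos]])
  have d2: "\<bar>pmf (binomial_pmf (l - 1) p) j * pmf (binomial_pmf h p) 0 - pois j (p * l) * pois 0 (p * h)\<bar> \<le> 2 * \<eta>" for j
    by (rule prod[OF b2 b3 pmf_nonneg pmf_le_1 pois_nonneg[OF pos] pois_le_1[OF pos]])
  define Q where "Q = (\<Sum>j<K-1. pmf (binomial_pmf (l - 1) p) j) * pmf (binomial_pmf h p) 0"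
  define T where "T = (\<Sum>j<K-1. pois j (p * l) * pois 0 (p * h))"
  have \<eta>0: "\<eta> \<ge> 0" using assms by (simp add: \<eta>)
  have "\<bar>Q - T\<bar> \<le> (\<Sum>j<K-1. \<bar>pmf (binomial_pmf (l - 1) p) j * pmf (binomial_pmf h p) 0 - pois j (p * l) * pois 0 (p * h)\<bar>)"
    unfolding Q_def T_def sum_distrib_right sum_subtractf[symmetric] by (rule sum_abs)
  also have "\<dots> \<le> (\<Sum>j<K-1. 2 * \<eta>)" by (intro sum_mono d2)
  also have "\<dots> \<le> K * (2 * \<eta>)" using \<eta>0 by (simp add: mult_right_mono)
  finally have QT: "\<bar>Q - T\<bar> \<le> K * (2 * \<eta>)" .
  have AQ: "\<bar>A_count n s i * (p * Q) - c * x i * T\<bar> \<le> c * (K * (2 * \<eta>))" for i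
  proof -
    have "A_count n s i * (p * Q) - c * x i * T = (A_count n s i * p) * (Q - T)"
      unfolding px by (simp add: algebra_simps)
    moreover have "A_count n s i * p \<le> c"
      using A[of i] assms by (simp add: p_def field_simps)
    then have "\<bar>(A_count n s i * p) * (Q - T)\<bar> \<le> c * (K * (2 * \<eta>))"
      unfolding abs_mult[of "_ * p"] using p assms by (intro mult_mono QT) (auto simp: abs_mult)
    ultimately show ?thesis by simp
  qed
  have cK: "c * (K * (2 * \<eta>)) \<ge> 0" using assms \<eta>0 by simp
  have "\<bar>mean_change n K p s k - delta c K x k\<bar> \<le> 2 * \<eta> + 2 * (c * (K * (2 * \<eta>)))"
    unfolding delta_pois[OF assms(3)] mean_change_def Let_def l_def[symmetric] h_def[symmetric] Q_def[symmetric] pl ph T_def[symmetric]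
    using d1[of k] AQ[of k] AQ[of "k-1"] cK by (cases "k = 0"; cases "k < K - 1") (simp_all, linarith+)
  also have "\<dots> = ((2 + 4 * c * K) * (2 * c\<^sup>2 + c)) / n"
    unfolding \<eta> by (simp add: algebra_simps add_divide_distrib)
  finally show ?thesis unfolding p_def x_def .
qed


section \<open>Supermartingale estimate for the squared deviation\<close>

lemma explored_place:
  assumes "v < n" "s v = Unexpl" "N \<subseteq> explored n s"
  shows "explored n (place K s v N) = insert v (explored n s)"
proof (rule set_eqI)
  fix u show "u \<in> explored n (place K s v N) \<longleftrightarrow> u \<in> insert v (explored n s)"
    using assms by (cases "s u") (auto simp: explored_def place_def)
qed

lemma valid_place:
  assumes "valid n K s" "v < n" "s v = Unexpl" "N \<subseteq> explored n s"
  shows "valid n K (place K s v N)"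
  unfolding valid_def
proof (intro allI impI)
  fix u k assume u: "u < n" and p: "place K s v N u = Act k"
  have old: "k < K" if "s u = Act k" using assms(1) u that by (auto simp: valid_def)
  show "k < K"
  proof (cases "accepts K s N")
    case True
    then have acc: "card {u\<in>N. \<exists>k. s u = Act k} < K" "\<And>w. w \<in> N \<Longrightarrow> s w \<noteq> Act (K-1)"
      by (auto simp: accepts_def)
    consider "u = v" | i where "u \<noteq> v" "u \<in> N" "s u = Act i" | "u \<noteq> v" "u \<notin> {u\<in>N. \<exists>k. s u = Act k}" by blast
    then show ?thesis
    proof cases
      case 1
      then show ?thesis using p True acc by (simp add: place_def)
    next
      case (2 i)
      then have "k = Suc i" using p True by (auto simp: place_def)
      moreover have "i < K" using assms(1) u 2 by (auto simp: valid_def)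
      moreover have "i \<noteq> K - 1" using acc(2)[OF 2(2)] 2(3) by auto
      ultimately show ?thesis by linarith
    next
      case 3
      then have "s u = Act k" using p True by (auto simp: place_def split: if_splits)
      then show ?thesis by (rule old)
    qed
  next
    case False
    then show ?thesis using p old by (auto simp: place_def split: if_splits)
  qed
qed

lemma unexplored_nonempty:
  assumes "card (explored n s) < n"
  shows "{v\<in>{..<n}. s v = Unexpl} \<noteq> {}"
proof
  assume "{v\<in>{..<n}. s v = Unexpl} = {}"
  then have "explored n s = {..<n}" by (auto simp: explored_def)
  then show False using assms by simp
qed

text \<open>Lets the number of explored vertices act as the clock, so that the time of a state can
  be read off the state itself.\<close>

lemma expl_step_support:
  assumes "valid n K s" "card (explored n s) < n" "s' \<in> set_pmf (expl_step n p K s)"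
  shows "valid n K s'" "card (explored n s') = Suc (card (explored n s))"
proof -
  have ne: "{v\<in>{..<n}. s v = Unexpl} \<noteq> {}" using assms(2) by (rule unexplored_nonempty)
  have "finite {v\<in>{..<n}. s v = Unexpl}" by simp
  then obtain v N where v: "v < n" "s v = Unexpl" and N: "N \<subseteq> explored n s" and s': "s' = place K s v N"
    using assms(3) set_random_subset[of "explored n s" p] ne unfolding expl_step_eq[OF ne]
    by (auto simp: set_pmf_of_set[OF ne])
  show "valid n K s'" unfolding s' by (rule valid_place[OF assms(1) v N])
  have "v \<notin> explored n s" using v by (simp add: explored_def)
  then show "card (explored n s') = Suc (card (explored n s))"
    unfolding s' explored_place[OF v N] by simp
qed

text \<open>The selected vertex is averaged out, so a bound for each candidate suffices. The
  neighbour set has finite support, which turns the nonnegative integral into the ordinary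
  expectation of the drift computation.\<close>

lemma nn_integral_expl_step_le:
  assumes "card (explored n s) < n" and nonneg: "\<And>s. f s \<ge> 0"
    and le: "\<And>v. v < n \<Longrightarrow> s v = Unexpl \<Longrightarrow>
      measure_pmf.expectation (random_subset (explored n s) p) (\<lambda>N. f (place K s v N)) \<le> M"
  shows "(\<integral>\<^sup>+s'. ennreal (f s') \<partial>expl_step n p K s) \<le> ennreal M"
proof -
  let ?U = "{v\<in>{..<n}. s v = Unexpl}"
  have ne: "?U \<noteq> {}" using assms(1) by (rule unexplored_nonempty)
  have fin: "finite ?U" by simp
  have "(\<integral>\<^sup>+N. ennreal (f (place K s v N)) \<partial>random_subset (explored n s) p) \<le> ennreal M" if "v \<in> ?U" for v
  proof -
    have "(\<integral>\<^sup>+N. ennreal (f (place K s v N)) \<partial>random_subset (explored n s) p)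
        = ennreal (measure_pmf.expectation (random_subset (explored n s) p) (\<lambda>N. f (place K s v N)))"
      by (intro nn_integral_eq_integral integrable_measure_pmf_finite finite_set_random_subset)
         (auto simp: nonneg)
    then show ?thesis using le[of v] that by (simp add: ennreal_leI)
  qed
  then have "(\<integral>\<^sup>+v. (\<integral>\<^sup>+N. ennreal (f (place K s v N)) \<partial>random_subset (explored n s) p) \<partial>pmf_of_set ?U)
      \<le> (\<integral>\<^sup>+v. ennreal M \<partial>pmf_of_set ?U)"
    by (intro nn_integral_mono_AE) (unfold AE_measure_pmf_iff set_pmf_of_set[OF ne fin], blast)
  then show ?thesis unfolding expl_step_eq[OF ne] by simp
qed

text \<open>Ville's inequality by induction on the number of remaining steps. If \<open>V\<close>
  has reached \<epsilon> already, the bound is at least 1. Otherwise the event concerns later times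
  only; the induction hypothesis is averaged over the next state and the supermartingale property
  closes the step.\<close>

lemma expl_traj_maximal_inequality:
  fixes V :: "nat \<Rightarrow> (nat \<Rightarrow> status) \<Rightarrow> real"
  assumes nonneg: "\<And>j s. V j s \<ge> 0" and "\<epsilon> > 0"
    and step: "\<And>j s. j < n \<Longrightarrow> valid n K s \<Longrightarrow> card (explored n s) = j \<Longrightarrow>
      (\<integral>\<^sup>+s'. ennreal (V (Suc j) s') \<partial>expl_step n p K s) \<le> ennreal (V j s)"
  assumes "j + m = n" "valid n K s" "card (explored n s) = j"
  shows "emeasure (expl_traj n p K m s) {xs. \<exists>i\<le>m. V (j + i) (xs ! i) \<ge> \<epsilon>} \<le> ennreal (V j s / \<epsilon>)"
  using assms(4-6)
proof (induction m arbitrary: j s)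
  case 0
  then show ?case using \<open>\<epsilon> > 0\<close> nonneg[of j s]
    by (auto simp: indicator_def emeasure_return_pmf simp flip: ennreal_1 intro!: ennreal_leI)
next
  case (Suc m)
  show ?case
  proof (cases "V j s \<ge> \<epsilon>")
    case True
    have "emeasure (expl_traj n p K (Suc m) s) {xs. \<exists>i\<le>Suc m. V (j + i) (xs ! i) \<ge> \<epsilon>} \<le> 1"
      by (rule measure_pmf.emeasure_le_1)
    also have "1 = ennreal 1" by simp
    also have "\<dots> \<le> ennreal (V j s / \<epsilon>)" using True \<open>\<epsilon> > 0\<close> by (intro ennreal_leI) auto
    finally show ?thesis .
  next
    case False
    have ev: "Cons s -` {xs. \<exists>i\<le>Suc m. V (j + i) (xs ! i) \<ge> \<epsilon>} = {xs. \<exists>i\<le>m. V (Suc j + i) (xs ! i) \<ge> \<epsilon>}"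
    proof (intro set_eqI iffI)
      fix xs assume "xs \<in> Cons s -` {xs. \<exists>i\<le>Suc m. V (j + i) (xs ! i) \<ge> \<epsilon>}"
      then obtain i where i: "i \<le> Suc m" "V (j + i) ((s # xs) ! i) \<ge> \<epsilon>" by auto
      with False obtain i' where "i = Suc i'" by (cases i) auto
      with i show "xs \<in> {xs. \<exists>i\<le>m. V (Suc j + i) (xs ! i) \<ge> \<epsilon>}" by auto
    next
      fix xs assume "xs \<in> {xs. \<exists>i\<le>m. V (Suc j + i) (xs ! i) \<ge> \<epsilon>}"
      then obtain i where "i \<le> m" "V (Suc j + i) (xs ! i) \<ge> \<epsilon>" by auto
      then show "xs \<in> Cons s -` {xs. \<exists>i\<le>Suc m. V (j + i) (xs ! i) \<ge> \<epsilon>}"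
        by (auto intro!: exI[of _ "Suc i"])
    qed
    have "emeasure (expl_traj n p K (Suc m) s) {xs. \<exists>i\<le>Suc m. V (j + i) (xs ! i) \<ge> \<epsilon>}
        = (\<integral>\<^sup>+s'. emeasure (expl_traj n p K m s') {xs. \<exists>i\<le>m. V (Suc j + i) (xs ! i) \<ge> \<epsilon>} \<partial>expl_step n p K s)"
      unfolding expl_traj.simps emeasure_bind_pmf emeasure_map_pmf ev ..
    also have "\<dots> \<le> (\<integral>\<^sup>+s'. ennreal (1 / \<epsilon>) * ennreal (V (Suc j) s') \<partial>expl_step n p K s)"
    proof (rule nn_integral_mono_AE, unfold AE_measure_pmf_iff, intro ballI)
      fix s' assume s': "s' \<in> set_pmf (expl_step n p K s)"
      have lt: "card (explored n s) < n" using Suc.prems by simp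
      have "emeasure (expl_traj n p K m s') {xs. \<exists>i\<le>m. V (Suc j + i) (xs ! i) \<ge> \<epsilon>} \<le> ennreal (V (Suc j) s' / \<epsilon>)"
        by (rule Suc.IH) (use expl_step_support[OF Suc.prems(2) lt s'] Suc.prems in auto)
      also have "\<dots> = ennreal (1 / \<epsilon>) * ennreal (V (Suc j) s')"
        using \<open>\<epsilon> > 0\<close> nonneg by (subst ennreal_mult[symmetric]) auto
      finally show "emeasure (expl_traj n p K m s') {xs. \<exists>i\<le>m. V (Suc j + i) (xs ! i) \<ge> \<epsilon>}
          \<le> ennreal (1 / \<epsilon>) * ennreal (V (Suc j) s')" .
    qed
    also have "\<dots> = ennreal (1 / \<epsilon>) * (\<integral>\<^sup>+s'. ennreal (V (Suc j) s') \<partial>expl_step n p K s)"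
      by (rule nn_integral_cmult) simp
    also have "\<dots> \<le> ennreal (1 / \<epsilon>) * ennreal (V j s)"
      by (intro mult_left_mono step) (use Suc.prems in auto)
    also have "\<dots> = ennreal (V j s / \<epsilon>)"
      using \<open>\<epsilon> > 0\<close> nonneg by (subst ennreal_mult[symmetric]) auto
    finally show ?thesis .
  qed
qed

definition sq_dev :: "nat \<Rightarrow> nat \<Rightarrow> (nat \<Rightarrow> real) \<Rightarrow> (nat \<Rightarrow> status) \<Rightarrow> real" where
  "sq_dev n K a s = (\<Sum>k<K. (A_count n s k / n - a k)\<^sup>2)"

lemma sq_dev_nonneg: "sq_dev n K a s \<ge> 0"
  by (simp add: sq_dev_def sum_nonneg)

text \<open>\<open>a\<close> and \<open>a'\<close> stand for the solution at consecutive grid times.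
  With d the increment of A_k / n minus that of the solution, (x - a + d)^2 is expanded. The mean of
  d is O(1/n^2) plus (L / n) times the l1 distance from the current state to \<open>a\<close>, and
  d^2 \<le> ((K + C) / n)^2. Summed over k, the cross terms produce the squared l1 distance, which
  Cauchy-Schwarz bounds by K times \<open>sq_dev\<close>.\<close>

lemma sq_dev_drift:
  assumes "valid n K s" "K \<ge> 1" "c > 0" "c \<le> real n" "n > 0" "v < n" "s v = Unexpl"
    and L: "L \<ge> 0" "\<And>k x y. k < K \<Longrightarrow> \<bar>delta1 c K x k - delta1 c K y k\<bar> \<le> L * (\<Sum>i<K. \<bar>x i - y i\<bar>)"
    and C: "C \<ge> 0" "\<And>k. k < K \<Longrightarrow> \<bar>a k\<bar> \<le> C" "\<And>k. k < K \<Longrightarrow> \<bar>a' k - a k\<bar> \<le> C / n"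
      "\<And>k. k < K \<Longrightarrow> \<bar>a' k - a k - delta1 c K a k / n\<bar> \<le> C / (real n)\<^sup>2"
    and D: "D = (2 + 4 * c * K) * (2 * c\<^sup>2 + c)"
  shows "measure_pmf.expectation (random_subset (explored n s) (c / n)) (\<lambda>N. sq_dev n K a' (place K s v N))
    \<le> (1 + 2 * L * K / n) * sq_dev n K a s + (2 * real K * (1 + C) * (D + C) + K * (K + C)\<^sup>2) / (real n)\<^sup>2"
proof -
  let ?R = "random_subset (explored n s) (c / n)"
  have int: "integrable (measure_pmf ?R) f" for f :: "nat set \<Rightarrow> real"
    by (intro integrable_measure_pmf_finite finite_set_random_subset) simp
  have p: "c / n \<in> {0..1}" using assms by simp
  define x where "x i = A_count n s i / n" for i
  have x: "0 \<le> x i \<and> x i \<le> 1" for i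
  proof -
    have "level n s i \<subseteq> {..<n}" by (auto simp: level_def)
    from card_mono[OF _ this] have "A_count n s i \<le> n" by (simp add: A_count_eq)
    then show ?thesis using assms by (simp add: x_def)
  qed
  define Sg where "Sg = (\<Sum>i<K. \<bar>x i - a i\<bar>)"
  define m where "m k = mean_change n K (c / n) s k" for k
  define h where "h k = a' k - a k" for k
  have D0: "D \<ge> 0" using assms by (simp add: D)
  have mh: "\<bar>m k / n - h k\<bar> \<le> (D + C) / (real n)\<^sup>2 + L / n * Sg" if k: "k < K" for k
  proof -
    \<comment> \<open>The state of the process lies in [0,1], where truncation is the identity; the
      curve \<open>a\<close> is compared through \<open>delta1\<close>, so no bound by 1 on it
      enters.\<close>
    have "delta c K x k = delta1 c K x k" using x by (simp add: delta1_def clamp1_id abs_le_iff)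
    then have "\<bar>m k - delta1 c K x k\<bar> \<le> D / n"
      using mean_change_delta[OF assms(1,2) k assms(3-5)] unfolding m_def x_def D by simp
    then have "\<bar>m k - delta1 c K x k\<bar> / n \<le> D / n / n" by (intro divide_right_mono) auto
    then have 1: "\<bar>m k / n - delta1 c K x k / n\<bar> \<le> D / (real n)\<^sup>2"
      by (simp add: power2_eq_square diff_divide_distrib[symmetric])
    have "\<bar>delta1 c K x k - delta1 c K a k\<bar> / n \<le> L * Sg / n"
      unfolding Sg_def by (intro divide_right_mono L k) auto
    then have 2: "\<bar>delta1 c K x k / n - delta1 c K a k / n\<bar> \<le> L / n * Sg"
      by (simp add: diff_divide_distrib[symmetric])
    have "\<bar>h k - delta1 c K a k / n\<bar> \<le> C / (real n)\<^sup>2" unfolding h_def by (rule C(4)[OF k])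
    then show ?thesis using 1 2 unfolding add_divide_distrib by linarith
  qed
  have one: "measure_pmf.expectation ?R (\<lambda>N. (A_count n (place K s v N) k / n - a' k)\<^sup>2)
      \<le> (x k - a k)\<^sup>2 + (2 * (1 + C) * ((D + C) / (real n)\<^sup>2) + 2 * L / n * Sg * \<bar>x k - a k\<bar>) + (K + C)\<^sup>2 / (real n)\<^sup>2"
    if k: "k < K" for k
  proof -
    let ?g = "\<lambda>N. (x k - a k)\<^sup>2 + 2 * (x k - a k) * (count_change n K s k N / n - h k) + (K + C)\<^sup>2 / (real n)\<^sup>2"
    have "measure_pmf.expectation ?R (\<lambda>N. (A_count n (place K s v N) k / n - a' k)\<^sup>2) \<le> measure_pmf.expectation ?R ?g"
    proof (rule integral_mono_AE[OF int int], unfold AE_measure_pmf_iff, intro ballI)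
      fix N assume "N \<in> set_pmf ?R"
      then have N: "N \<subseteq> explored n s" using set_random_subset[of "explored n s"] by auto
      let ?d = "count_change n K s k N / n - h k"
      have "\<bar>count_change n K s k N / n\<bar> \<le> K / n"
        using count_change_bound[OF assms(1) N assms(2) k] by (simp add: divide_right_mono)
      moreover have "\<bar>h k\<bar> \<le> C / n" unfolding h_def by (rule C(3)[OF k])
      ultimately have "\<bar>?d\<bar> \<le> (K + C) / n" unfolding add_divide_distrib by linarith
      then have "\<bar>?d\<bar>\<^sup>2 \<le> ((K + C) / n)\<^sup>2" by (intro power_mono) auto
      then have sq: "?d\<^sup>2 \<le> (K + C)\<^sup>2 / (real n)\<^sup>2" by (simp only: power2_abs power_divide)
      have eq: "A_count n (place K s v N) k / n - a' k = (x k - a k) + ?d"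
        unfolding A_count_place[OF assms(1) N assms(2,6,7)] x_def h_def by (simp add: add_divide_distrib)
      show "(A_count n (place K s v N) k / n - a' k)\<^sup>2 \<le> ?g N"
        unfolding eq power2_sum[of "x k - a k"] using sq by linarith
    qed
    also have "\<dots> = (x k - a k)\<^sup>2 + 2 * (x k - a k) * (m k / n - h k) + (K + C)\<^sup>2 / (real n)\<^sup>2"
    proof -
      have "measure_pmf.expectation ?R ?g = (x k - a k)\<^sup>2
        + 2 * (x k - a k) * (measure_pmf.expectation ?R (count_change n K s k) / n - h k) + (K + C)\<^sup>2 / (real n)\<^sup>2"
        by (simp add: int Bochner_Integration.integral_add Bochner_Integration.integral_diff)
      then show ?thesis unfolding m_def expectation_count_change[OF assms(1,2) k p] .
    qed
    also have "2 * (x k - a k) * (m k / n - h k) \<le> 2 * \<bar>x k - a k\<bar> * ((D + C) / (real n)\<^sup>2 + L / n * Sg)"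
    proof -
      have "2 * (x k - a k) * (m k / n - h k) \<le> \<bar>2 * (x k - a k) * (m k / n - h k)\<bar>" by simp
      also have "\<dots> = 2 * \<bar>x k - a k\<bar> * \<bar>m k / n - h k\<bar>" by (simp only: abs_mult abs_numeral)
      also have "\<dots> \<le> 2 * \<bar>x k - a k\<bar> * ((D + C) / (real n)\<^sup>2 + L / n * Sg)" by (intro mult_left_mono mh k) auto
      finally show ?thesis .
    qed
    also have "2 * \<bar>x k - a k\<bar> * ((D + C) / (real n)\<^sup>2 + L / n * Sg)
        = 2 * \<bar>x k - a k\<bar> * ((D + C) / (real n)\<^sup>2) + 2 * L / n * Sg * \<bar>x k - a k\<bar>" by (simp add: algebra_simps)
    also have "2 * \<bar>x k - a k\<bar> * ((D + C) / (real n)\<^sup>2) \<le> 2 * (1 + C) * ((D + C) / (real n)\<^sup>2)"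
    proof (intro mult_right_mono mult_left_mono)
      show "\<bar>x k - a k\<bar> \<le> 1 + C" using x[of k] C(2)[OF k] by linarith
    qed (use C(1) D0 in auto)
    finally show ?thesis by simp
  qed
  have "measure_pmf.expectation ?R (\<lambda>N. sq_dev n K a' (place K s v N))
      = (\<Sum>k<K. measure_pmf.expectation ?R (\<lambda>N. (A_count n (place K s v N) k / n - a' k)\<^sup>2))"
    unfolding sq_dev_def by (rule Bochner_Integration.integral_sum[OF int])
  also have "\<dots> \<le> (\<Sum>k<K. (x k - a k)\<^sup>2 + (2 * (1 + C) * ((D + C) / (real n)\<^sup>2) + 2 * L / n * Sg * \<bar>x k - a k\<bar>) + (K + C)\<^sup>2 / (real n)\<^sup>2)"
    by (intro sum_mono one) auto
  also have "\<dots> = sq_dev n K a s + 2 * L / n * (Sg * Sg) + (2 * real K * (1 + C) * (D + C) + K * (K + C)\<^sup>2) / (real n)\<^sup>2"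
  proof -
    have e1: "(\<Sum>k<K. 2 * L / n * Sg * \<bar>x k - a k\<bar>) = 2 * L / n * (Sg * Sg)"
      unfolding sum_distrib_left[symmetric] Sg_def[symmetric] by simp
    have e2: "(\<Sum>k<K. (x k - a k)\<^sup>2) = sq_dev n K a s" by (simp add: sq_dev_def x_def)
    have e3: "(\<Sum>k<K. 2 * (1 + C) * ((D + C) / (real n)\<^sup>2)) = 2 * real K * (1 + C) * (D + C) / (real n)\<^sup>2"
      unfolding sum_constant card_lessThan times_divide_eq_right by (simp only: mult_ac)
    have e4: "(\<Sum>k<K. (K + C)\<^sup>2 / (real n)\<^sup>2) = K * (K + C)\<^sup>2 / (real n)\<^sup>2"
      unfolding sum_constant card_lessThan times_divide_eq_right ..
    show ?thesis
      unfolding sum.distrib e1 e2 e3 e4 unfolding add_divide_distrib by linarith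
  qed
  also have "2 * L / n * (Sg * Sg) \<le> 2 * L / n * (K * sq_dev n K a s)"
  proof (intro mult_left_mono)
    have "Sg * Sg \<le> (\<Sum>i<K. \<bar>x i - a i\<bar>\<^sup>2) * card {..<K}"
      unfolding Sg_def power2_eq_square[symmetric] by (rule sum_squared_le_sum_of_squares)
    then show "Sg * Sg \<le> K * sq_dev n K a s" by (simp add: sq_dev_def x_def mult.commute)
  qed (use L in auto)
  finally show ?thesis by (simp add: algebra_simps)
qed


section \<open>Uniform convergence of the exploration process\<close>

lemma has_integral_increment:
  fixes f :: "real \<Rightarrow> real"
  assumes "\<And>t. t \<in> {0..1} \<Longrightarrow> (f has_integral u t) {0..t}" "0 \<le> t" "t \<le> t'" "t' \<le> 1"
  shows "(f has_integral (u t' - u t)) {t..t'}"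
proof -
  have t: "(f has_integral u t) {0..t}" and t': "(f has_integral u t') {0..t'}" using assms by auto
  have "f integrable_on {t..t'}"
    by (rule integrable_subinterval_real[OF has_integral_integrable[OF t']]) (use assms in auto)
  then have j: "(f has_integral integral {t..t'} f) {t..t'}" by (rule integrable_integral)
  have "(f has_integral u t + integral {t..t'} f) {0..t'}"
    by (rule has_integral_combine[OF assms(2,3) t j])
  then have "u t + integral {t..t'} f = u t'" using t' by (rule has_integral_unique)
  then show ?thesis using j by (metis add_diff_cancel_left')
qed

text \<open>The second bound is the local error of an Euler step: by the first bound the integrand
  moves by at most C * K * C * (t' - t) on the interval. With t' - t = 1/n this is the O(1/n^2)
  accuracy required by the drift estimate.\<close>

lemma integral_equation_increments:
  fixes u :: "nat \<Rightarrow> real \<Rightarrow> real"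
  assumes C: "C \<ge> 0" "\<And>k x. k < K \<Longrightarrow> \<bar>F k x\<bar> \<le> C"
    "\<And>k x y. k < K \<Longrightarrow> \<bar>F k x - F k y\<bar> \<le> C * (\<Sum>i<K. \<bar>x i - y i\<bar>)"
    and u: "\<And>k t. k < K \<Longrightarrow> t \<in> {0..1} \<Longrightarrow> ((\<lambda>s. F k (\<lambda>i. u i s)) has_integral u k t) {0..t}"
    and t: "0 \<le> t" "t \<le> t'" "t' \<le> 1" and "k < K"
  shows "\<bar>u k t' - u k t\<bar> \<le> C * (t' - t)"
    and "\<bar>u k t' - u k t - (t' - t) * F k (\<lambda>i. u i t)\<bar> \<le> C * K * C * (t' - t)\<^sup>2"
proof -
  have I: "((\<lambda>s. F k (\<lambda>i. u i s)) has_integral (u k s' - u k s)) {s..s'}"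
    if "0 \<le> s" "s \<le> s'" "s' \<le> 1" "k < K" for k s s'
    by (rule has_integral_increment[where u = "u k"]) (use u that in auto)
  have lip: "\<bar>u k s' - u k s\<bar> \<le> C * (s' - s)" if "0 \<le> s" "s \<le> s'" "s' \<le> 1" "k < K" for k s s'
    using has_integral_bound_real[OF C(1) finite.emptyI I[OF that]] C(2)[OF that(4)] that by simp
  show "\<bar>u k t' - u k t\<bar> \<le> C * (t' - t)" by (rule lip[OF t \<open>k < K\<close>])
  let ?c = "F k (\<lambda>i. u i t)"
  have J: "((\<lambda>s. F k (\<lambda>i. u i s) - ?c) has_integral (u k t' - u k t - (t' - t) * ?c)) {t..t'}"
    using has_integral_diff[OF I[OF t \<open>k < K\<close>] has_integral_const_real[of ?c t t']] t by simp
  have "norm (u k t' - u k t - (t' - t) * ?c) \<le> (C * K * C * (t' - t)) * Henstock_Kurzweil_Integration.content {t..t'}"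
  proof (rule has_integral_bound_real[OF _ finite.emptyI J])
    fix s assume s: "s \<in> {t..t'} - {}"
    have "\<bar>F k (\<lambda>i. u i s) - ?c\<bar> \<le> C * (\<Sum>i<K. \<bar>u i s - u i t\<bar>)" by (rule C(3)[OF \<open>k < K\<close>])
    also have "\<dots> \<le> C * (\<Sum>i<K. C * (t' - t))"
    proof (intro mult_left_mono sum_mono C(1))
      fix i assume "i \<in> {..<K}"
      then have "\<bar>u i s - u i t\<bar> \<le> C * (s - t)" using s t by (intro lip) auto
      also have "\<dots> \<le> C * (t' - t)" using s C(1) by (intro mult_left_mono) auto
      finally show "\<bar>u i s - u i t\<bar> \<le> C * (t' - t)" .
    qed
    finally show "norm (F k (\<lambda>i. u i s) - ?c) \<le> C * K * C * (t' - t)" by (simp add: mult_ac)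
  qed (use C(1) t in auto)
  then show "\<bar>u k t' - u k t - (t' - t) * ?c\<bar> \<le> C * K * C * (t' - t)\<^sup>2"
    using t by (simp add: power2_eq_square mult_ac)
qed

text \<open>The deviation vanishes at time 0, since u k 0 = 0 and no vertex is active, so the
  supermartingale starts at its correction term alone, a constant over n. Its weight on
  \<open>sq_dev\<close> is at least 1 throughout, so it dominates the deviation. The curve solves
  the truncated equation, because the bound that makes it a solution of the original one is derived
  from this estimate.\<close>

lemma expl_process_deviation:
  fixes u :: "nat \<Rightarrow> real \<Rightarrow> real"
  assumes "c > 0" "K \<ge> 1"
    and u: "\<And>k t. k < K \<Longrightarrow> t \<in> {0..1} \<Longrightarrow> ((\<lambda>s. delta1 c K (\<lambda>i. u i s) k) has_integral u k t) {0..t}"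
  obtains G where "\<And>n \<eta>. n > 0 \<Longrightarrow> c \<le> real n \<Longrightarrow> \<eta> > 0 \<Longrightarrow>
    measure_pmf.prob (expl_process c K n) {xs. \<exists>i\<le>n. sq_dev n K (\<lambda>k. u k (i / n)) (xs ! i) \<ge> \<eta>} \<le> G / (n * \<eta>)"
proof -
  obtain C where C: "C \<ge> 0" "\<And>k x. k < K \<Longrightarrow> \<bar>delta1 c K x k\<bar> \<le> C"
    "\<And>k x y. k < K \<Longrightarrow> \<bar>delta1 c K x k - delta1 c K y k\<bar> \<le> C * (\<Sum>i<K. \<bar>x i - y i\<bar>)"
    by (rule delta1_lipschitz[of K c]) (rule that; blast)
  have inc: "\<bar>u k t' - u k t\<bar> \<le> C * (t' - t)"
    "\<bar>u k t' - u k t - (t' - t) * delta1 c K (\<lambda>i. u i t) k\<bar> \<le> C * K * C * (t' - t)\<^sup>2"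
    if "0 \<le> t" "t \<le> t'" "t' \<le> 1" "k < K" for k t t'
    using integral_equation_increments[where F = "\<lambda>k x. delta1 c K x k" and u = u, OF C(1) _ _ _ that] C u
    by auto
  have u0: "u k 0 = 0" if "k < K" for k
    using u[OF that, of 0] by (simp add: has_integral_is_0 has_integral_iff)
  \<comment> \<open>One constant dominating the bound on the curve, the bound on its increments and
    the Euler error, as the drift estimate asks for a single C.\<close>
  define B where "B = C + C * K * C"
  have CB: "C \<le> B" "C * K * C \<le> B" "B \<ge> 0" using C(1) by (auto simp: B_def)
  define \<beta> where "\<beta> = 2 * C * K"
  define D where "D = (2 + 4 * c * K) * (2 * c\<^sup>2 + c)"
  define \<Gamma> where "\<Gamma> = 2 * real K * (1 + B) * (D + B) + K * (K + B)\<^sup>2"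
  have nn: "\<beta> \<ge> 0" "\<Gamma> \<ge> 0" "D \<ge> 0" using C(1) CB assms(1) by (auto simp: \<beta>_def \<Gamma>_def D_def)
  show ?thesis
  proof (rule that[of "exp \<beta> * \<Gamma>"])
    fix n :: nat and \<eta> :: real assume n: "n > 0" "c \<le> real n" and "\<eta> > 0"
    define a where "a j k = u k (j / n)" for j :: nat and k
    \<comment> \<open>The drift multiplies the expected deviation by at most \<open>1 + \<beta> / n\<close> and adds \<open>\<Gamma> / n\<^sup>2\<close>;
      this correction makes it a supermartingale.\<close>
    define V where "V j s = (1 + \<beta> / n) ^ (n - j) * sq_dev n K (a j) s + real (n - j) * (exp \<beta> * \<Gamma> / (real n)\<^sup>2)"
      for j :: nat and s
    have ge1: "1 + \<beta> / n \<ge> 1" using nn by simp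
    have Vdev: "sq_dev n K (a j) s \<le> V j s" for j s
    proof -
      have "1 * sq_dev n K (a j) s \<le> (1 + \<beta> / n) ^ (n - j) * sq_dev n K (a j) s"
        using one_le_power[OF ge1] sq_dev_nonneg by (rule mult_right_mono)
      moreover have "real (n - j) * (exp \<beta> * \<Gamma> / (real n)\<^sup>2) \<ge> 0" using nn by simp
      ultimately show ?thesis by (simp add: V_def)
    qed
    have V0: "V j s \<ge> 0" for j s using Vdev[of j s] sq_dev_nonneg[of n K "a j" s] by linarith
    have step: "(\<integral>\<^sup>+s'. ennreal (V (Suc j) s') \<partial>expl_step n (c / n) K s) \<le> ennreal (V j s)"
      if j: "j < n" "valid n K s" "card (explored n s) = j" for j s
    proof (rule nn_integral_expl_step_le)
      show "card (explored n s) < n" using j by simp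
      fix v assume v: "v < n" "s v = Unexpl"
      let ?R = "random_subset (explored n s) (c / n)"
      let ?q = "(1 + \<beta> / n) ^ (n - Suc j)" and ?e = "exp \<beta> * \<Gamma> / (real n)\<^sup>2"
      have tj: "0 \<le> j / n" "j / n \<le> Suc j / n" "Suc j / n \<le> 1" "Suc j / n - j / n = 1 / n"
        using j n by (auto simp: field_simps)
      have "measure_pmf.expectation ?R (\<lambda>N. sq_dev n K (a (Suc j)) (place K s v N))
          \<le> (1 + \<beta> / n) * sq_dev n K (a j) s + \<Gamma> / (real n)\<^sup>2"
        unfolding \<beta>_def \<Gamma>_def
      proof (rule sq_dev_drift[OF j(2) assms(2,1) n(2,1) v C(1) C(3) CB(3)])
        fix k assume k: "k < K"
        have "\<bar>u k (j / n) - u k 0\<bar> \<le> C * (j / n - 0)" using tj j by (intro inc(1) k) auto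
        also have "\<dots> \<le> C * 1" using tj C(1) by (intro mult_left_mono) auto
        finally show "\<bar>a j k\<bar> \<le> B" using CB u0[OF k] by (simp add: a_def)
        have "\<bar>a (Suc j) k - a j k\<bar> \<le> C * (1 / n)"
          unfolding a_def using inc(1)[OF tj(1-3) k] unfolding tj(4) .
        also have "\<dots> \<le> B * (1 / n)" using CB by (intro mult_right_mono) auto
        finally show "\<bar>a (Suc j) k - a j k\<bar> \<le> B / n" by simp
        have "\<bar>a (Suc j) k - a j k - (1 / n) * delta1 c K (a j) k\<bar> \<le> C * K * C * (1 / n)\<^sup>2"
          unfolding a_def using inc(2)[OF tj(1-3) k] unfolding tj(4) .
        also have "\<dots> \<le> B * (1 / n)\<^sup>2" using CB by (intro mult_right_mono) auto
        finally show "\<bar>a (Suc j) k - a j k - delta1 c K (a j) k / n\<bar> \<le> B / (real n)\<^sup>2"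
          by (simp add: power_divide)
      qed (assumption | rule D_def)+
      then have "?q * measure_pmf.expectation ?R (\<lambda>N. sq_dev n K (a (Suc j)) (place K s v N))
          \<le> ?q * ((1 + \<beta> / n) * sq_dev n K (a j) s + \<Gamma> / (real n)\<^sup>2)"
        using ge1 by (intro mult_left_mono) auto
      also have "\<dots> = (1 + \<beta> / n) ^ (n - j) * sq_dev n K (a j) s + ?q * (\<Gamma> / (real n)\<^sup>2)"
        using j(1) by (simp add: distrib_left mult_ac flip: power_Suc Suc_diff_Suc)
      \<comment> \<open>By (1 + \<beta> / n)^n \<le> exp \<beta> the weighted error of a step has a
        bound independent of j; the linear correction in V pays this amount once per remaining
        step.\<close>
      also have "?q * (\<Gamma> / (real n)\<^sup>2) \<le> exp \<beta> * (\<Gamma> / (real n)\<^sup>2)"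
      proof (intro mult_right_mono)
        have "?q \<le> (1 + \<beta> / n) ^ n" using ge1 by (intro power_increasing) auto
        also have "\<dots> \<le> exp (\<beta> / n) ^ n" using nn by (intro power_mono exp_ge_add_one_self) auto
        also have "\<dots> = exp \<beta>" using n by (simp flip: exp_of_nat_mult)
        finally show "?q \<le> exp \<beta>" .
      qed (use nn in auto)
      finally have main: "?q * measure_pmf.expectation ?R (\<lambda>N. sq_dev n K (a (Suc j)) (place K s v N))
          \<le> (1 + \<beta> / n) ^ (n - j) * sq_dev n K (a j) s + ?e" by simp
      have "measure_pmf.expectation ?R (\<lambda>N. V (Suc j) (place K s v N))
          = ?q * measure_pmf.expectation ?R (\<lambda>N. sq_dev n K (a (Suc j)) (place K s v N)) + real (n - Suc j) * ?e"
        unfolding V_def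
        by (subst Bochner_Integration.integral_add)
           (auto intro!: integrable_measure_pmf_finite finite_set_random_subset)
      also have "\<dots> \<le> (1 + \<beta> / n) ^ (n - j) * sq_dev n K (a j) s + ?e + real (n - Suc j) * ?e"
        using main by simp
      also have "\<dots> = V j s"
      proof -
        have "real (n - j) = real (n - Suc j) + 1" using j(1) by simp
        then show ?thesis unfolding V_def by (simp only: distrib_right mult_1_left add_ac)
      qed
      finally show "measure_pmf.expectation ?R (\<lambda>N. V (Suc j) (place K s v N)) \<le> V j s" .
    qed (rule V0)+
    define s0 where "s0 = (\<lambda>_::nat. Unexpl)"
    have "V 0 s0 = real n * (exp \<beta> * \<Gamma> / (real n)\<^sup>2)"
      unfolding V_def by (simp add: sq_dev_def a_def u0 A_count_def s0_def)
    then have V00: "V 0 s0 / \<eta> = exp \<beta> * \<Gamma> / (n * \<eta>)"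
      using n by (simp add: power2_eq_square)
    have "emeasure (expl_traj n (c / n) K n s0) {xs. \<exists>i\<le>n. V (0 + i) (xs ! i) \<ge> \<eta>} \<le> ennreal (V 0 s0 / \<eta>)"
    proof (rule expl_traj_maximal_inequality[where V = V and n = n])
      show "(\<integral>\<^sup>+s'. ennreal (V (Suc j) s') \<partial>expl_step n (c / n) K s) \<le> ennreal (V j s)"
        if "j < n" "valid n K s" "card (explored n s) = j" for j s using that by (rule step)
    qed (use \<open>\<eta> > 0\<close> V0 in \<open>auto simp: valid_def s0_def explored_def\<close>)
    then have "measure_pmf.prob (expl_process c K n) {xs. \<exists>i\<le>n. V i (xs ! i) \<ge> \<eta>} \<le> V 0 s0 / \<eta>"
      unfolding expl_process_def s0_def[symmetric] using V0[of 0 s0] \<open>\<eta> > 0\<close>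
      by (simp add: measure_pmf.emeasure_eq_measure)
    moreover have "measure_pmf.prob (expl_process c K n) {xs. \<exists>i\<le>n. sq_dev n K (a i) (xs ! i) \<ge> \<eta>}
        \<le> measure_pmf.prob (expl_process c K n) {xs. \<exists>i\<le>n. V i (xs ! i) \<ge> \<eta>}"
      by (intro measure_pmf.finite_measure_mono) (auto intro: order_trans[OF _ Vdev])
    ultimately show "measure_pmf.prob (expl_process c K n) {xs. \<exists>i\<le>n. sq_dev n K (\<lambda>k. u k (i / n)) (xs ! i) \<ge> \<eta>}
        \<le> exp \<beta> * \<Gamma> / (n * \<eta>)"
      unfolding V00 a_def by simp
  qed
qed

text \<open>Between grid points \<open>alpha_n\<close> is constant and the curve moves by at most C
  / n, which is at most \<epsilon> / 2 for large n. A deviation above \<epsilon> at some t therefore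
  forces one of at least \<epsilon> / 2 at the grid point below t, hence a squared deviation of at
  least (\<epsilon> / 2)^2.\<close>

lemma expl_process_converges:
  fixes u :: "nat \<Rightarrow> real \<Rightarrow> real"
  assumes "c > 0" "K \<ge> 1"
    and u: "\<And>k t. k < K \<Longrightarrow> t \<in> {0..1} \<Longrightarrow> ((\<lambda>s. delta1 c K (\<lambda>i. u i s) k) has_integral u k t) {0..t}"
    and "\<epsilon> > 0"
  shows "(\<lambda>n. measure_pmf.prob (expl_process c K n)
      {xs. \<exists>t\<in>{0..1}. \<exists>k<K. \<bar>alpha_n n xs k t - u k t\<bar> > \<epsilon>}) \<longlonglongrightarrow> 0"
proof -
  obtain C where C: "C \<ge> 0" "\<And>k x. k < K \<Longrightarrow> \<bar>delta1 c K x k\<bar> \<le> C"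
    "\<And>k x y. k < K \<Longrightarrow> \<bar>delta1 c K x k - delta1 c K y k\<bar> \<le> C * (\<Sum>i<K. \<bar>x i - y i\<bar>)"
    by (rule delta1_lipschitz[of K c]) (rule that; blast)
  have inc: "\<bar>u k t' - u k t\<bar> \<le> C * (t' - t)" if "0 \<le> t" "t \<le> t'" "t' \<le> 1" "k < K" for k t t'
    using integral_equation_increments(1)[where F = "\<lambda>k x. delta1 c K x k" and u = u, OF C(1) _ _ _ that] C u
    by auto
  obtain G where G: "\<And>n \<eta>. n > 0 \<Longrightarrow> c \<le> real n \<Longrightarrow> \<eta> > 0 \<Longrightarrow>
    measure_pmf.prob (expl_process c K n) {xs. \<exists>i\<le>n. sq_dev n K (\<lambda>k. u k (i / n)) (xs ! i) \<ge> \<eta>} \<le> G / (n * \<eta>)"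
    by (rule expl_process_deviation[OF assms(1,2) u]; (assumption | (rule that; blast)))
  let ?E = "\<lambda>n. {xs. \<exists>t\<in>{0..1}. \<exists>k<K. \<bar>alpha_n n xs k t - u k t\<bar> > \<epsilon>}"
  have bound: "measure_pmf.prob (expl_process c K n) (?E n) \<le> G / (n * (\<epsilon> / 2)\<^sup>2)"
    if n: "n > 0" "c \<le> real n" "2 * C / \<epsilon> \<le> real n" for n
  proof -
    have "?E n \<subseteq> {xs. \<exists>i\<le>n. sq_dev n K (\<lambda>k. u k (i / n)) (xs ! i) \<ge> (\<epsilon> / 2)\<^sup>2}"
    proof (intro subsetI, elim CollectE bexE exE conjE)
      fix xs t k assume t: "t \<in> {0..1}" and k: "k < K" and gt: "\<bar>alpha_n n xs k t - u k t\<bar> > \<epsilon>"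
      define i where "i = nat \<lfloor>real n * t\<rfloor>"
      have nt: "0 \<le> real n * t" "real n * t \<le> n" using t by (auto simp: mult_left_le)
      have i: "real i \<le> real n * t" "real n * t < real i + 1" using nt unfolding i_def by linarith+
      have "i \<le> n" using i nt by linarith
      have "t \<le> (real i + 1) / n" using i n by (simp add: pos_le_divide_eq mult.commute)
      moreover have "real i / n \<le> t" using i n by (simp add: pos_divide_le_eq mult.commute)
      ultimately have tn: "real i / n \<le> t" "t - real i / n \<le> 1 / n" by (simp_all add: add_divide_distrib)
      have "\<bar>u k t - u k (i / n)\<bar> \<le> C * (t - i / n)"
        using tn t k by (intro inc) auto
      also have "\<dots> \<le> C * (1 / n)" using tn C(1) by (intro mult_left_mono) auto
      also have "\<dots> \<le> \<epsilon> / 2" using n \<open>\<epsilon> > 0\<close> by (simp add: field_simps)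
      finally have "\<epsilon> / 2 \<le> \<bar>A_count n (xs ! i) k / n - u k (i / n)\<bar>"
        using gt unfolding alpha_n_def i_def[symmetric] by linarith
      then have "(\<epsilon> / 2)\<^sup>2 \<le> \<bar>A_count n (xs ! i) k / n - u k (i / n)\<bar>\<^sup>2"
        using \<open>\<epsilon> > 0\<close> by (intro power_mono) auto
      also have "\<dots> \<le> sq_dev n K (\<lambda>k. u k (i / n)) (xs ! i)"
        unfolding power2_abs sq_dev_def
        using k by (intro member_le_sum[of k "{..<K}" "\<lambda>k. (A_count n (xs ! i) k / n - u k (i / n))\<^sup>2"]) auto
      finally show "xs \<in> {xs. \<exists>i\<le>n. sq_dev n K (\<lambda>k. u k (i / n)) (xs ! i) \<ge> (\<epsilon> / 2)\<^sup>2}"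
        using \<open>i \<le> n\<close> by blast
    qed
    then have "measure_pmf.prob (expl_process c K n) (?E n)
        \<le> measure_pmf.prob (expl_process c K n) {xs. \<exists>i\<le>n. sq_dev n K (\<lambda>k. u k (i / n)) (xs ! i) \<ge> (\<epsilon> / 2)\<^sup>2}"
      by (intro measure_pmf.finite_measure_mono) auto
    also have "\<dots> \<le> G / (n * (\<epsilon> / 2)\<^sup>2)" using n \<open>\<epsilon> > 0\<close> by (intro G) auto
    finally show ?thesis .
  qed
  have ev: "eventually (\<lambda>n. measure_pmf.prob (expl_process c K n) (?E n) \<le> G / (n * (\<epsilon> / 2)\<^sup>2)) sequentially"
  proof (rule eventually_sequentiallyI)
    fix n assume n: "max 1 (max (nat \<lceil>c\<rceil>) (nat \<lceil>2 * C / \<epsilon>\<rceil>)) \<le> n"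
    show "measure_pmf.prob (expl_process c K n) (?E n) \<le> G / (n * (\<epsilon> / 2)\<^sup>2)"
      by (rule bound) (use n in linarith)+
  qed
  have "(\<lambda>n. G / (\<epsilon> / 2)\<^sup>2 * inverse (real n)) \<longlonglongrightarrow> G / (\<epsilon> / 2)\<^sup>2 * 0"
    by (intro tendsto_mult tendsto_const lim_inverse_n)
  then have lim: "(\<lambda>n. G / (n * (\<epsilon> / 2)\<^sup>2)) \<longlonglongrightarrow> 0" by (simp add: field_simps)
  show ?thesis
    by (rule tendsto_sandwich[OF always_eventually ev tendsto_const lim]) simp
qed

text \<open>The fractions of the process lie in \<open>[0, 1]\<close>, so the truncation is inactive along
  their limit.\<close>

lemma is_solution_exists:
  assumes "c > 0" "K \<ge> 1"
  obtains u where "is_solution c K u"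
    and "\<And>k t. k < K \<Longrightarrow> t \<in> {0..1} \<Longrightarrow> ((\<lambda>s. delta1 c K (\<lambda>i. u i s) k) has_integral u k t) {0..t}"
proof -
  obtain C where C: "C \<ge> 0" "\<And>k x. k < K \<Longrightarrow> \<bar>delta1 c K x k\<bar> \<le> C"
    "\<And>k x y. k < K \<Longrightarrow> \<bar>delta1 c K x k - delta1 c K y k\<bar> \<le> C * (\<Sum>i<K. \<bar>x i - y i\<bar>)"
    by (rule delta1_lipschitz[of K c]) (rule that; blast)
  have "\<exists>u :: nat \<Rightarrow> real \<Rightarrow> real. \<forall>k<K. \<forall>t\<in>{0..1}. ((\<lambda>s. delta1 c K (\<lambda>i. u i s) k) has_integral u k t) {0..t}"
  proof (rule lipschitz_integral_equation_exists[where F = "\<lambda>k x. delta1 c K x k" and K = K])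
    fix u :: "nat \<Rightarrow> real \<Rightarrow> real"
    assume "\<And>k t. k < K \<Longrightarrow> t \<in> {0..1} \<Longrightarrow> ((\<lambda>s. delta1 c K (\<lambda>i. u i s) k) has_integral u k t) {0..t}"
    then show ?thesis by (intro exI[of _ u]) blast
  qed (fact C)+
  then obtain u :: "nat \<Rightarrow> real \<Rightarrow> real"
    where u: "\<And>k t. k < K \<Longrightarrow> t \<in> {0..1} \<Longrightarrow> ((\<lambda>s. delta1 c K (\<lambda>i. u i s) k) has_integral u k t) {0..t}"
    by blast
  have le1: "\<bar>u k t\<bar> \<le> 1" if k: "k < K" and t: "t \<in> {0..1}" for k t
  proof (rule ccontr)
    assume "\<not> \<bar>u k t\<bar> \<le> 1"
    \<comment> \<open>Half the excess over 1. Since \<open>alpha_n\<close> lies in [0,1], every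
      trajectory deviates from u k t by at least 2 * \<epsilon>, so an event whose probability tends
      to 0 would be the whole space for every n.\<close>
    define \<epsilon> where "\<epsilon> = (\<bar>u k t\<bar> - 1) / 2"
    have \<epsilon>: "\<epsilon> > 0" using \<open>\<not> \<bar>u k t\<bar> \<le> 1\<close> by (simp add: \<epsilon>_def)
    have u_eq: "\<bar>u k t\<bar> = 1 + 2 * \<epsilon>" by (simp add: \<epsilon>_def field_simps)
    have "{xs. \<exists>t\<in>{0..1}. \<exists>k<K. \<bar>alpha_n n xs k t - u k t\<bar> > \<epsilon>} = UNIV" for n
    proof -
      have "\<bar>alpha_n n xs k t - u k t\<bar> > \<epsilon>" for xs
      proof -
        have "level n (xs ! nat \<lfloor>real n * t\<rfloor>) k \<subseteq> {..<n}" by (auto simp: level_def)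
        from card_mono[OF _ this] have "0 \<le> alpha_n n xs k t \<and> alpha_n n xs k t \<le> 1"
          by (auto simp: alpha_n_def A_count_eq divide_simps)
        then show ?thesis using \<epsilon> u_eq by linarith
      qed
      then show ?thesis using k t by blast
    qed
    then have "(\<lambda>n::nat. 1 :: real) \<longlonglongrightarrow> 0"
      using expl_process_converges[OF assms u \<epsilon>] by simp
    then show False by (simp add: LIMSEQ_const_iff)
  qed
  show ?thesis
  proof (rule that[OF _ u])
    show "is_solution c K u"
      unfolding is_solution_def
    proof (intro allI impI ballI)
      fix k t assume k: "k < K" and t: "t \<in> {0..(1::real)}"
      show "((\<lambda>s. delta c K (\<lambda>i. u i s) k) has_integral u k t) {0..t}"
      proof (rule has_integral_eq[OF _ u[OF k t]])
        fix s assume "s \<in> {0..t}"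
        then have "s \<in> {0..1}" using t by auto
        then have "clamp1 (u i s) = u i s" if "i < K" for i using le1[OF that] by (simp add: clamp1_id)
        then show "delta1 c K (\<lambda>i. u i s) k = delta c K (\<lambda>i. u i s) k"
          using k by (auto simp: delta1_def delta_def alpha_le_def S_fun_def Let_def)
      qed
    qed
  qed
qed


section \<open>Deferred decisions: the threshold model as an exploration\<close>

definition active :: "nat \<Rightarrow> (nat \<Rightarrow> status) \<Rightarrow> nat set" where
  "active n s = {v\<in>{..<n}. \<exists>k. s v = Act k}"

definition pairs_inside :: "nat \<Rightarrow> nat set \<Rightarrow> (nat \<times> nat) set" where
  "pairs_inside n X = {(i, j). i < j \<and> j < n \<and> i \<in> X \<and> j \<in> X}"

text \<open>The pairs still undecided when X has been explored: those with at least one endpoint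
  outside X.\<close>

definition pairs_outside :: "nat \<Rightarrow> nat set \<Rightarrow> (nat \<times> nat) set" where
  "pairs_outside n X = {(i, j). i < j \<and> j < n} - pairs_inside n X"

definition edge_to :: "nat \<Rightarrow> nat \<Rightarrow> nat \<times> nat" where
  "edge_to v u = (min u v, max u v)"

lemma finite_pairs_outside [simp]: "finite (pairs_outside n X)"
proof (rule finite_subset)
  show "pairs_outside n X \<subseteq> {..<n} \<times> {..<n}" by (auto simp: pairs_outside_def)
qed simp

lemma inj_on_edge_to: "v \<notin> X \<Longrightarrow> inj_on (edge_to v) X"
  by (auto simp: inj_on_def edge_to_def min_def max_def split: if_splits)

text \<open>Selecting v reveals exactly the pairs joining it to X. The disjointness makes these
  edges independent of those that remain undecided.\<close>

lemma pairs_outside_insert: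
  assumes "X \<subseteq> {..<n}" "v < n" "v \<notin> X"
  shows "pairs_outside n X = edge_to v ` X \<union> pairs_outside n (insert v X)"
    and "edge_to v ` X \<inter> pairs_outside n (insert v X) = {}"
proof -
  show "edge_to v ` X \<inter> pairs_outside n (insert v X) = {}"
    using assms by (auto simp: pairs_outside_def pairs_inside_def edge_to_def min_def max_def split: if_splits)
  have "edge_to v ` X \<subseteq> pairs_outside n X"
  proof (rule image_subsetI)
    fix u assume u: "u \<in> X"
    then consider "u < v" | "v < u" using assms(3) by (metis linorder_neqE_nat)
    then show "edge_to v u \<in> pairs_outside n X"
      by cases (use assms u in \<open>auto simp: pairs_outside_def pairs_inside_def edge_to_def\<close>)
  qed
  moreover have "(i, j) \<in> edge_to v ` X"
    if "(i, j) \<in> pairs_outside n X" "(i, j) \<notin> pairs_outside n (insert v X)" for i j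
  proof -
    have "i < j" "j < n" "i \<in> insert v X" "j \<in> insert v X" "\<not> (i \<in> X \<and> j \<in> X)"
      using that by (auto simp: pairs_outside_def pairs_inside_def)
    then have "i = v \<and> j \<in> X \<and> edge_to v j = (i, j) \<or> j = v \<and> i \<in> X \<and> edge_to v i = (i, j)"
      by (auto simp: edge_to_def)
    then show ?thesis by (metis imageI)
  qed
  moreover have "pairs_outside n (insert v X) \<subseteq> pairs_outside n X"
    by (auto simp: pairs_outside_def pairs_inside_def)
  ultimately show "pairs_outside n X = edge_to v ` X \<union> pairs_outside n (insert v X)"
    by (auto 4 4)
qed

text \<open>An undecided pair has an endpoint outside insert v X, so adjacency among these vertices
  is determined by the revealed edges, whatever \<open>E2\<close> is.\<close>

lemma adj_extended:
  assumes "E0 \<subseteq> pairs_inside n X" "N \<subseteq> X" "E2 \<subseteq> pairs_outside n (insert v X)" "v \<notin> X"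
    and "X \<subseteq> {..<n}" "v < n"
  shows "u \<in> X \<Longrightarrow> w \<in> X \<Longrightarrow> adj (E0 \<union> edge_to v ` N \<union> E2) u w \<longleftrightarrow> adj E0 u w"
    and "w \<in> X \<Longrightarrow> adj (E0 \<union> edge_to v ` N \<union> E2) v w \<longleftrightarrow> w \<in> N"
    and "u \<in> X \<Longrightarrow> adj (E0 \<union> edge_to v ` N \<union> E2) u v \<longleftrightarrow> u \<in> N"
proof -
  let ?E = "E0 \<union> edge_to v ` N \<union> E2"
  have sym: "adj E a b \<longleftrightarrow> adj E b a" for E a b
    unfolding adj_def by (metis min.commute max.commute)
  show "adj ?E u w \<longleftrightarrow> adj E0 u w" if "u \<in> X" "w \<in> X"
  proof -
    have "(min u w, max u w) \<notin> edge_to v ` N"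
      using that assms(2,4) by (auto simp: edge_to_def min_def max_def split: if_splits)
    moreover have "(min u w, max u w) \<notin> E2" if "u \<noteq> w"
    proof -
      have "(min u w, max u w) \<in> pairs_inside n (insert v X)"
        using that \<open>u \<in> X\<close> \<open>w \<in> X\<close> assms(5) by (auto simp: pairs_inside_def min_def max_def)
      then show ?thesis using assms(3) by (auto simp: pairs_outside_def)
    qed
    ultimately show ?thesis by (auto simp: adj_def)
  qed
  show vw: "adj ?E v w \<longleftrightarrow> w \<in> N" if w: "w \<in> X" for w
  proof -
    have "w \<noteq> v" using w assms by auto
    have e: "(min v w, max v w) = edge_to v w" by (simp add: edge_to_def min.commute max.commute)
    have "edge_to v w \<notin> E0" using assms(1,4) by (auto simp: pairs_inside_def edge_to_def min_def max_def)
    moreover have "edge_to v w \<notin> E2"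
      using pairs_outside_insert(2)[OF assms(5,6,4)] assms(3) w by auto
    moreover have "edge_to v w \<in> edge_to v ` N \<longleftrightarrow> w \<in> N"
      using inj_on_image_mem_iff[OF inj_on_edge_to[OF assms(4)] w assms(2)] .
    ultimately show ?thesis using \<open>w \<noteq> v\<close> by (auto simp: adj_def e)
  qed
  show "adj ?E u v \<longleftrightarrow> u \<in> N" if "u \<in> X" using vw[OF that] sym by blast
qed

text \<open>The invariant linking the two models: the level stored by the exploration is the degree
  in the subgraph induced by the active set, computed from the revealed edges
  \<open>E0\<close>.\<close>

definition coupled :: "nat \<Rightarrow> nat \<Rightarrow> (nat \<times> nat) set \<Rightarrow> (nat \<Rightarrow> status) \<Rightarrow> bool" where
  "coupled n K E0 s \<longleftrightarrow> E0 \<subseteq> pairs_inside n (explored n s) \<and> valid n K s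
     \<and> (\<forall>v\<in>active n s. s v = Act (card {w\<in>active n s. adj E0 v w}))"

lemma active_subset_explored: "active n s \<subseteq> explored n s"
  by (auto simp: active_def explored_def)

lemma finite_active [simp]: "finite (active n s)"
  by (simp add: active_def)

lemma active_neighbours:
  assumes "N \<subseteq> explored n s"
  shows "{u\<in>N. \<exists>k. s u = Act k} = N \<inter> active n s"
  using assms by (auto simp: active_def explored_def)

lemma active_place:
  assumes "v < n" "s v = Unexpl" "N \<subseteq> explored n s"
  shows "active n (place K s v N) = (if accepts K s N then insert v (active n s) else active n s)"
proof (rule set_eqI)
  fix u show "u \<in> active n (place K s v N) \<longleftrightarrow> u \<in> (if accepts K s N then insert v (active n s) else active n s)"
    using assms by (cases "s u") (auto simp: active_def place_def)
qed

lemma degrees_extended: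
  assumes "coupled n K E0 s" "v < n" "s v = Unexpl" "N \<subseteq> explored n s"
    and "E2 \<subseteq> pairs_outside n (insert v (explored n s))"
  defines "E \<equiv> E0 \<union> edge_to v ` N \<union> E2" and "J \<equiv> insert v (active n s)"
  shows "{w\<in>J. adj E v w} = N \<inter> active n s"
    and "u \<in> active n s \<Longrightarrow> s u = Act d \<Longrightarrow> card {w\<in>J. adj E u w} = (if u \<in> N then Suc d else d)"
    and "u \<in> active n s \<Longrightarrow> {w\<in>active n s. adj E u w} = {w\<in>active n s. adj E0 u w}"
proof -
  have v: "v \<notin> explored n s" "v \<notin> active n s" using assms(3) by (auto simp: explored_def active_def)
  have sub: "explored n s \<subseteq> {..<n}" by (auto simp: explored_def)
  have E0: "E0 \<subseteq> pairs_inside n (explored n s)" using assms(1) by (simp add: coupled_def)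
  note A = adj_extended[OF E0 assms(4,5) v(1) sub assms(2), folded E_def]
  have "\<not> adj E v v" by (simp add: adj_def)
  then show "{w\<in>J. adj E v w} = N \<inter> active n s"
    using A(2) active_subset_explored[of n s] by (auto simp: J_def)
  show same: "{w\<in>active n s. adj E u w} = {w\<in>active n s. adj E0 u w}" if "u \<in> active n s" for u
    using A(1) that active_subset_explored[of n s] by blast
  show "card {w\<in>J. adj E u w} = (if u \<in> N then Suc d else d)" if u: "u \<in> active n s" and d: "s u = Act d"
  proof -
    have "card {w\<in>active n s. adj E0 u w} = d" using assms(1) u d by (auto simp: coupled_def)
    moreover have "{w\<in>J. adj E u w} = (if u \<in> N then insert v {w\<in>active n s. adj E0 u w} else {w\<in>active n s. adj E0 u w})"
      using A(3)[of u] u active_subset_explored[of n s] same[OF u] unfolding J_def by auto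
    ultimately show ?thesis using v by auto
  qed
qed

text \<open>Active vertices have degree below K and the new vertex raises a degree by at most one.
  The bound can thus fail only at the new vertex itself or at one of its neighbours of degree K - 1,
  which are the two reasons for rejection in the exploration.\<close>

lemma threshold_condition_iff:
  assumes "coupled n K E0 s" "v < n" "s v = Unexpl" "N \<subseteq> explored n s"
    and "E2 \<subseteq> pairs_outside n (insert v (explored n s))" "K \<ge> 1"
  defines "E \<equiv> E0 \<union> edge_to v ` N \<union> E2" and "J \<equiv> insert v (active n s)"
  shows "(\<forall>u\<in>J. card {w\<in>J. adj E u w} < K) \<longleftrightarrow> accepts K s N"
proof -
  note deg = degrees_extended[OF assms(1-5), folded E_def J_def]
  have lt: "d < K" if "u \<in> active n s" "s u = Act d" for u d
    using assms(1) that by (auto simp: coupled_def valid_def active_def)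
  have other: "card {w\<in>J. adj E u w} < K \<longleftrightarrow> (u \<in> N \<longrightarrow> s u \<noteq> Act (K-1))" if u: "u \<in> active n s" for u
  proof -
    obtain d where d: "s u = Act d" using u by (auto simp: active_def)
    show ?thesis using deg(2)[OF u d] lt[OF u d] d assms(6) by auto
  qed
  have "(\<forall>u\<in>J. card {w\<in>J. adj E u w} < K) \<longleftrightarrow>
     card (N \<inter> active n s) < K \<and> (\<forall>u\<in>active n s. card {w\<in>J. adj E u w} < K)"
    unfolding deg(1)[symmetric] by (simp add: J_def)
  also have "\<dots> \<longleftrightarrow> card (N \<inter> active n s) < K \<and> (\<forall>u\<in>N \<inter> active n s. s u \<noteq> Act (K-1))"
    using other by blast
  also have "\<dots> \<longleftrightarrow> accepts K s N"
    unfolding accepts_def active_neighbours[OF assms(4)] by simp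
  finally show ?thesis .
qed

lemma coupled_place:
  assumes "coupled n K E0 s" "v < n" "s v = Unexpl" "N \<subseteq> explored n s"
  shows "coupled n K (E0 \<union> edge_to v ` N) (place K s v N)"
proof -
  let ?E = "E0 \<union> edge_to v ` N" and ?s = "place K s v N"
  have ex: "explored n ?s = insert v (explored n s)" by (rule explored_place[OF assms(2-4)])
  have E0: "E0 \<subseteq> pairs_inside n (explored n s)" and val: "valid n K s"
    using assms(1) by (auto simp: coupled_def)
  have v: "v \<notin> N" "v \<notin> active n s" using assms(3,4) by (auto simp: explored_def active_def)
  \<comment> \<open>The degree formulas are taken with no undecided edges, since the invariant
    refers to the revealed graph only.\<close>
  note deg = degrees_extended[OF assms empty_subsetI, unfolded Un_empty_right]
  have "edge_to v ` N \<subseteq> pairs_inside n (insert v (explored n s))"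
  proof (rule image_subsetI)
    fix u assume u: "u \<in> N"
    then consider "u < v" | "v < u" using v(1) by (metis linorder_neqE_nat)
    then show "edge_to v u \<in> pairs_inside n (insert v (explored n s))"
      by cases (use assms(2-4) u in \<open>auto simp: pairs_inside_def edge_to_def explored_def\<close>)
  qed
  then have "?E \<subseteq> pairs_inside n (explored n ?s)"
    using E0 unfolding ex by (auto simp: pairs_inside_def)
  moreover have "valid n K ?s" by (rule valid_place[OF val assms(2-4)])
  moreover have "?s u = Act (card {w\<in>active n ?s. adj ?E u w})" if u: "u \<in> active n ?s" for u
  proof (cases "accepts K s N")
    case False
    then have "active n ?s = active n s" by (simp add: active_place[OF assms(2-4)])
    moreover have "?s u = s u" using False u v calculation by (auto simp: place_def)
    moreover have "s u = Act (card {w\<in>active n s. adj E0 u w})"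
      using assms(1) u calculation(1) by (auto simp: coupled_def)
    ultimately show ?thesis using deg(3)[of u] u by simp
  next
    case True
    then have act: "active n ?s = insert v (active n s)" by (simp add: active_place[OF assms(2-4)])
    show ?thesis
    proof (cases "u = v")
      case True
      show ?thesis unfolding True act deg(1) using \<open>accepts K s N\<close>
        by (simp add: place_def active_neighbours[OF assms(4)])
    next
      case False
      then have ua: "u \<in> active n s" using u act by auto
      then obtain d where d: "s u = Act d" by (auto simp: active_def)
      show ?thesis using deg(2)[OF ua d] False \<open>accepts K s N\<close> d unfolding act
        by (auto simp: place_def)
    qed
  qed
  ultimately show ?thesis by (simp add: coupled_def)
qed

lemma thr_step_eq:
  assumes "{..<n} - Sel \<noteq> {}"
  shows "thr_step n K E (I, Sel) = pmf_of_set ({..<n} - Sel) \<bind> (\<lambda>v. return_pmf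
    (if \<forall>u\<in>insert v I. card {w\<in>insert v I. adj E u w} < K then insert v I else I, insert v Sel))"
  using assms unfolding thr_step_def Let_def fst_conv snd_conv
  by (simp only: if_False) (intro bind_pmf_cong refl; simp)

text \<open>Principle of deferred decisions: the edges not inside the explored set are still
  independent of the past, and those between the next vertex and the explored set are revealed
  when that vertex is selected.\<close>

lemma threshold_explored_coupling:
  assumes "coupled n K E0 s" "K \<ge> 1"
  shows "map_pmf fst (random_subset (pairs_outside n (explored n s)) p \<bind>
      (\<lambda>E1. thr_iter n K (E0 \<union> E1) m (active n s, explored n s)))
    = map_pmf (\<lambda>xs. active n (xs ! m)) (expl_traj n p K m s)"
  using assms(1)
proof (induction m arbitrary: E0 s)
  case 0
  then show ?case by simp
next
  case (Suc m)
  let ?X = "explored n s" and ?I = "active n s"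
  let ?U = "{v\<in>{..<n}. s v = Unexpl}"
  have U: "{..<n} - ?X = ?U" by (auto simp: explored_def)
  have nth: "(\<lambda>xs. active n (xs ! Suc m)) \<circ> Cons s = (\<lambda>xs. active n (xs ! m))" by auto
  have rhs: "map_pmf (\<lambda>xs. active n (xs ! Suc m)) (expl_traj n p K (Suc m) s)
      = expl_step n p K s \<bind> (\<lambda>s'. map_pmf (\<lambda>xs. active n (xs ! m)) (expl_traj n p K m s'))"
    by (simp add: map_bind_pmf pmf.map_comp nth)
  show ?case
  proof (cases "?U = {}")
    case True
    then have "expl_step n p K s = return_pmf s" by (simp add: expl_step_def)
    moreover have "thr_step n K E (?I, ?X) = return_pmf (?I, ?X)" for E
      using U unfolding True by (simp add: thr_step_def Let_def)
    ultimately show ?thesis unfolding rhs using Suc.IH[OF Suc.prems] by (simp add: bind_return_pmf)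
  next
    case False
    define nxt where "nxt E v = (if \<forall>u\<in>insert v ?I. card {w\<in>insert v ?I. adj E u w} < K then insert v ?I else ?I, insert v ?X)" for E v
    have step: "thr_step n K E (?I, ?X) = pmf_of_set ?U \<bind> (\<lambda>v. return_pmf (nxt E v))" for E
      unfolding nxt_def using thr_step_eq[of n ?X K E ?I] False unfolding U by blast
    have one: "map_pmf fst (random_subset (pairs_outside n ?X) p \<bind> (\<lambda>E1. thr_iter n K (E0 \<union> E1) m (nxt (E0 \<union> E1) v)))
      = random_subset ?X p \<bind> (\<lambda>N. map_pmf (\<lambda>xs. active n (xs ! m)) (expl_traj n p K m (place K s v N)))"
      if v: "v \<in> ?U" for v
    proof -
      have v': "v < n" "s v = Unexpl" "v \<notin> ?X" using v by (auto simp: explored_def)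
      have X: "?X \<subseteq> {..<n}" by (auto simp: explored_def)
      let ?O = "pairs_outside n (insert v ?X)"
      \<comment> \<open>The edges between v and the explored set are the image of the neighbour set
        that the exploration draws, and they are independent of the other undecided edges.\<close>
      have "random_subset (pairs_outside n ?X) p = map_pmf (\<lambda>(a, b). a \<union> b)
          (pair_pmf (map_pmf ((`) (edge_to v)) (random_subset ?X p)) (random_subset ?O p))"
        unfolding pairs_outside_insert(1)[OF X v'(1,3)]
        by (subst random_subset_Un[OF _ _ pairs_outside_insert(2)[OF X v'(1,3)]])
           (simp_all add: random_subset_image[OF _ inj_on_edge_to[OF v'(3)]])
      then have "random_subset (pairs_outside n ?X) p \<bind> (\<lambda>E1. thr_iter n K (E0 \<union> E1) m (nxt (E0 \<union> E1) v))
        = random_subset ?X p \<bind> (\<lambda>N. random_subset ?O p \<bind> (\<lambda>E2.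
            thr_iter n K (E0 \<union> edge_to v ` N \<union> E2) m (nxt (E0 \<union> edge_to v ` N \<union> E2) v)))"
        by (simp add: pair_pmf_def map_pmf_def bind_assoc_pmf bind_return_pmf Un_assoc)
      then have "map_pmf fst (random_subset (pairs_outside n ?X) p \<bind> (\<lambda>E1. thr_iter n K (E0 \<union> E1) m (nxt (E0 \<union> E1) v)))
        = random_subset ?X p \<bind> (\<lambda>N. map_pmf fst (random_subset ?O p \<bind> (\<lambda>E2.
            thr_iter n K (E0 \<union> edge_to v ` N \<union> E2) m (nxt (E0 \<union> edge_to v ` N \<union> E2) v))))"
        by (simp add: map_bind_pmf)
      also have "\<dots> = random_subset ?X p \<bind> (\<lambda>N. map_pmf (\<lambda>xs. active n (xs ! m)) (expl_traj n p K m (place K s v N)))"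
      proof (rule bind_pmf_cong[OF refl])
        fix N assume "N \<in> set_pmf (random_subset ?X p)"
        then have N: "N \<subseteq> ?X" using set_random_subset[of ?X p] by auto
        let ?s = "place K s v N"
        have ex: "explored n ?s = insert v ?X" by (rule explored_place[OF v'(1,2) N])
        have "random_subset ?O p \<bind> (\<lambda>E2. thr_iter n K (E0 \<union> edge_to v ` N \<union> E2) m (nxt (E0 \<union> edge_to v ` N \<union> E2) v))
          = random_subset ?O p \<bind> (\<lambda>E2. thr_iter n K (E0 \<union> edge_to v ` N \<union> E2) m (active n ?s, explored n ?s))"
        proof (rule bind_pmf_cong[OF refl])
          fix E2 assume "E2 \<in> set_pmf (random_subset ?O p)"
          then have E2: "E2 \<subseteq> ?O" using set_random_subset[of ?O p] by auto
          \<comment> \<open>The next state does not depend on \<open>E2\<close>, so these edges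
            remain fresh randomness for the induction hypothesis.\<close>
          have "nxt (E0 \<union> edge_to v ` N \<union> E2) v = (active n ?s, explored n ?s)"
            unfolding nxt_def threshold_condition_iff[OF Suc.prems v'(1,2) N E2 assms(2)]
              active_place[OF v'(1,2) N] ex ..
          then show "thr_iter n K (E0 \<union> edge_to v ` N \<union> E2) m (nxt (E0 \<union> edge_to v ` N \<union> E2) v)
            = thr_iter n K (E0 \<union> edge_to v ` N \<union> E2) m (active n ?s, explored n ?s)" by simp
        qed
        then show "map_pmf fst (random_subset ?O p \<bind> (\<lambda>E2. thr_iter n K (E0 \<union> edge_to v ` N \<union> E2) m (nxt (E0 \<union> edge_to v ` N \<union> E2) v)))
          = map_pmf (\<lambda>xs. active n (xs ! m)) (expl_traj n p K m ?s)"
          using Suc.IH[OF coupled_place[OF Suc.prems v'(1,2) N]] unfolding ex by simp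
      qed
      finally show ?thesis .
    qed
    have "random_subset (pairs_outside n ?X) p \<bind> (\<lambda>E1. thr_iter n K (E0 \<union> E1) (Suc m) (?I, ?X))
       = random_subset (pairs_outside n ?X) p \<bind> (\<lambda>E1. pmf_of_set ?U \<bind> (\<lambda>v. thr_iter n K (E0 \<union> E1) m (nxt (E0 \<union> E1) v)))"
      by (simp add: step bind_assoc_pmf bind_return_pmf)
    \<comment> \<open>The vertex is drawn from a set that does not depend on the undecided edges, so
      the two draws commute and the edges may be sampled after the vertex is known.\<close>
    also have "\<dots> = pmf_of_set ?U \<bind> (\<lambda>v. random_subset (pairs_outside n ?X) p \<bind> (\<lambda>E1. thr_iter n K (E0 \<union> E1) m (nxt (E0 \<union> E1) v)))"
      by (rule bind_commute_pmf)
    finally have "map_pmf fst (random_subset (pairs_outside n ?X) p \<bind> (\<lambda>E1. thr_iter n K (E0 \<union> E1) (Suc m) (?I, ?X)))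
       = pmf_of_set ?U \<bind> (\<lambda>v. map_pmf fst (random_subset (pairs_outside n ?X) p \<bind> (\<lambda>E1. thr_iter n K (E0 \<union> E1) m (nxt (E0 \<union> E1) v))))"
      by (simp only: map_bind_pmf)
    also have "\<dots> = pmf_of_set ?U \<bind> (\<lambda>v. random_subset ?X p \<bind> (\<lambda>N. map_pmf (\<lambda>xs. active n (xs ! m)) (expl_traj n p K m (place K s v N))))"
    proof (rule bind_pmf_cong[OF refl])
      fix v assume "v \<in> set_pmf (pmf_of_set ?U)"
      then have "v \<in> ?U" using set_pmf_of_set[OF False] by simp
      then show "map_pmf fst (random_subset (pairs_outside n ?X) p \<bind> (\<lambda>E1. thr_iter n K (E0 \<union> E1) m (nxt (E0 \<union> E1) v)))
        = random_subset ?X p \<bind> (\<lambda>N. map_pmf (\<lambda>xs. active n (xs ! m)) (expl_traj n p K m (place K s v N)))"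
        by (rule one)
    qed
    finally show ?thesis unfolding rhs expl_step_eq[OF False]
      by (simp only: bind_assoc_pmf bind_map_pmf)
  qed
qed

lemma threshold_final_eq:
  assumes "K \<ge> 1"
  shows "threshold_final c K n = map_pmf (\<lambda>xs. active n (xs ! n)) (expl_process c K n)"
proof -
  let ?s = "\<lambda>_::nat. Unexpl"
  have "explored n ?s = {}" "active n ?s = {}" "pairs_outside n {} = {(i, j). i < j \<and> j < n}"
    by (auto simp: explored_def active_def pairs_outside_def pairs_inside_def)
  moreover have "coupled n K {} ?s" using calculation by (simp add: coupled_def valid_def)
  ultimately show ?thesis
    using threshold_explored_coupling[of n K "{}" ?s "c / n" n] assms
    by (simp add: threshold_final_def gnp_def expl_process_def map_bind_pmf)
qed

text \<open>Validity of the final state ensures that the levels below K exhaust the active set, so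
  that its size is the sum of the K counts.\<close>

lemma expl_traj_valid:
  assumes "valid n K s" "card (explored n s) + m = n" "xs \<in> set_pmf (expl_traj n p K m s)"
  shows "valid n K (xs ! m)"
  using assms
proof (induction m arbitrary: s xs)
  case 0
  then show ?case by simp
next
  case (Suc m)
  then obtain s' ys where s': "s' \<in> set_pmf (expl_step n p K s)"
    and ys: "ys \<in> set_pmf (expl_traj n p K m s')" "xs = s # ys" by auto
  have "card (explored n s) < n" using Suc.prems by simp
  from expl_step_support[OF Suc.prems(1) this s'] have "valid n K (ys ! m)"
    using Suc.prems(2) ys by (intro Suc.IH) auto
  then show ?case using ys by simp
qed

lemma card_active:
  assumes "valid n K s"
  shows "card (active n s) = (\<Sum>k<K. A_count n s k)"
proof -
  have "active n s = (\<Union>k<K. level n s k)"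
    using assms by (auto simp: active_def level_def valid_def)
  then show ?thesis unfolding A_count_eq
    by (simp only:) (rule card_UN_disjoint; auto simp: level_def)
qed


section \<open>Convergence in distribution of the final size\<close>

text \<open>The limiting cdf jumps at x, so only points y \<noteq> x matter. There the event X \<le>
  y, or its complement, forces a deviation of at least the distance from x to y; half of this
  distance serves as a threshold that is strictly exceeded.\<close>

lemma weak_conv_m_return:
  fixes X :: "nat \<Rightarrow> 'a \<Rightarrow> real"
  assumes conv: "\<And>\<epsilon>. \<epsilon> > 0 \<Longrightarrow> (\<lambda>n. measure_pmf.prob (M n) {\<omega>. \<bar>X n \<omega> - x\<bar> > \<epsilon>}) \<longlonglongrightarrow> 0"
  shows "weak_conv_m (\<lambda>n. distr (measure_pmf (M n)) borel (X n)) (return borel x)"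
  unfolding weak_conv_m_def weak_conv_def
proof (intro allI impI)
  fix y assume cont: "isCont (cdf (return borel x)) y"
  have cdf_ret: "cdf (return borel x) = (\<lambda>y. if x \<le> y then 1 else 0)"
    by (auto simp: cdf_def measure_return)
  have cdf_X: "cdf (distr (measure_pmf (M n)) borel (X n)) y = measure_pmf.prob (M n) {\<omega>. X n \<omega> \<le> y}" for n
    by (simp add: cdf_def measure_distr vimage_def)
  \<comment> \<open>At the jump the cdf is not left-continuous: it is 0 at x - 1/(n+1) and 1 at
    x.\<close>
  have "y \<noteq> x"
  proof
    assume "y = x"
    have "(\<lambda>n. x + - inverse (real (Suc n))) \<longlonglongrightarrow> x"
      by (rule LIMSEQ_inverse_real_of_nat_add_minus)
    with cont have "(\<lambda>n. cdf (return borel x) (x + - inverse (real (Suc n)))) \<longlonglongrightarrow> cdf (return borel x) x"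
      unfolding \<open>y = x\<close> by (rule isCont_tendsto_compose)
    then show False unfolding cdf_ret by (simp add: LIMSEQ_const_iff)
  qed
  then consider "y < x" | "x < y" by linarith
  then show "(\<lambda>n. cdf (distr (measure_pmf (M n)) borel (X n)) y) \<longlonglongrightarrow> cdf (return borel x) y"
  proof cases
    case 1
    have ev: "eventually (\<lambda>n. measure_pmf.prob (M n) {\<omega>. X n \<omega> \<le> y}
        \<le> measure_pmf.prob (M n) {\<omega>. \<bar>X n \<omega> - x\<bar> > (x - y) / 2}) sequentially"
    proof (intro always_eventually allI measure_pmf.finite_measure_mono subsetI)
      fix n \<omega> assume "\<omega> \<in> {\<omega>. X n \<omega> \<le> y}"
      then have "X n \<omega> \<le> y" by simp
      then have "\<bar>X n \<omega> - x\<bar> \<ge> x - y" by linarith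
      moreover have "(x - y) / 2 < x - y" using 1 by simp
      ultimately show "\<omega> \<in> {\<omega>. \<bar>X n \<omega> - x\<bar> > (x - y) / 2}" by simp
    qed simp
    have "(\<lambda>n. measure_pmf.prob (M n) {\<omega>. X n \<omega> \<le> y}) \<longlonglongrightarrow> 0"
      by (rule tendsto_sandwich[OF always_eventually ev tendsto_const conv]) (use 1 in auto)
    then show ?thesis using 1 unfolding cdf_X cdf_ret by simp
  next
    case 2
    have ge: "1 - measure_pmf.prob (M n) {\<omega>. \<bar>X n \<omega> - x\<bar> > (y - x) / 2} \<le> measure_pmf.prob (M n) {\<omega>. X n \<omega> \<le> y}" for n
    proof -
      have "measure_pmf.prob (M n) (- {\<omega>. X n \<omega> \<le> y}) \<le> measure_pmf.prob (M n) {\<omega>. \<bar>X n \<omega> - x\<bar> > (y - x) / 2}"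
      proof (intro measure_pmf.finite_measure_mono subsetI)
        fix \<omega> assume "\<omega> \<in> - {\<omega>. X n \<omega> \<le> y}"
        then have "X n \<omega> > y" by simp
        then have "\<bar>X n \<omega> - x\<bar> > y - x" by linarith
        moreover have "(y - x) / 2 < y - x" using 2 by simp
        ultimately show "\<omega> \<in> {\<omega>. \<bar>X n \<omega> - x\<bar> > (y - x) / 2}" by simp
      qed simp
      then show ?thesis using measure_pmf.prob_compl[of "{\<omega>. X n \<omega> \<le> y}" "M n"] by (simp add: Compl_eq_Diff_UNIV)
    qed
    have "(\<lambda>n. 1 - measure_pmf.prob (M n) {\<omega>. \<bar>X n \<omega> - x\<bar> > (y - x) / 2}) \<longlonglongrightarrow> 1 - 0"
      by (intro tendsto_diff tendsto_const conv) (use 2 in auto)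
    then have lim: "(\<lambda>n. 1 - measure_pmf.prob (M n) {\<omega>. \<bar>X n \<omega> - x\<bar> > (y - x) / 2}) \<longlonglongrightarrow> 1" by simp
    have "(\<lambda>n. measure_pmf.prob (M n) {\<omega>. X n \<omega> \<le> y}) \<longlonglongrightarrow> 1"
      by (rule tendsto_sandwich[OF always_eventually always_eventually lim tendsto_const]) (use ge in auto)
    then show ?thesis using 2 unfolding cdf_X cdf_ret by simp
  qed
qed

text \<open>If the sum of K deviations exceeds \<epsilon>, one of them exceeds \<epsilon> / K. The
  final active set is the state at time t = 1, since the floor of n * 1 is n.\<close>

lemma threshold_final_deviation:
  assumes "K \<ge> 1" "\<epsilon> > 0" "n > 0"
  shows "measure_pmf.prob (threshold_final c K n) {I. \<bar>real (card I) / n - (\<Sum>k<K. al k 1)\<bar> > \<epsilon>}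
    \<le> measure_pmf.prob (expl_process c K n) {xs. \<exists>t\<in>{0..1}. \<exists>k<K. \<bar>alpha_n n xs k t - al k t\<bar> > \<epsilon> / K}"
  unfolding threshold_final_eq[OF assms(1)] measure_map_pmf
proof (rule measure_pmf.finite_measure_mono_AE, unfold AE_measure_pmf_iff, intro ballI impI)
  fix xs assume xs: "xs \<in> set_pmf (expl_process c K n)"
    and dev: "xs \<in> (\<lambda>xs. active n (xs ! n)) -` {I. \<bar>real (card I) / n - (\<Sum>k<K. al k 1)\<bar> > \<epsilon>}"
  have "valid n K (xs ! n)"
    by (rule expl_traj_valid[where s = "\<lambda>_. Unexpl"])
       (use xs in \<open>auto simp: expl_process_def valid_def explored_def\<close>)
  then have "real (card (active n (xs ! n))) / n = (\<Sum>k<K. alpha_n n xs k 1)"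
    by (simp add: card_active alpha_n_def sum_divide_distrib)
  then have "\<epsilon> < \<bar>\<Sum>k<K. alpha_n n xs k 1 - al k 1\<bar>"
    using dev by (simp add: sum_subtractf)
  also have "\<dots> \<le> (\<Sum>k<K. \<bar>alpha_n n xs k 1 - al k 1\<bar>)" by (rule sum_abs)
  finally have gt: "\<epsilon> < (\<Sum>k<K. \<bar>alpha_n n xs k 1 - al k 1\<bar>)" .
  have "\<exists>k<K. \<bar>alpha_n n xs k 1 - al k 1\<bar> > \<epsilon> / K"
  proof (rule ccontr)
    assume "\<not> ?thesis"
    then have "\<bar>alpha_n n xs k 1 - al k 1\<bar> \<le> \<epsilon> / K" if "k < K" for k using that by (meson not_less)
    then have "(\<Sum>k<K. \<bar>alpha_n n xs k 1 - al k 1\<bar>) \<le> (\<Sum>k<K. \<epsilon> / K)" by (intro sum_mono) auto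
    also have "\<dots> = \<epsilon>" using assms(1) by simp
    finally show False using gt by simp
  qed
  then show "xs \<in> {xs. \<exists>t\<in>{0..1}. \<exists>k<K. \<bar>alpha_n n xs k t - al k t\<bar> > \<epsilon> / K}"
    by (intro CollectI bexI[of _ 1]) auto
qed simp

theorem theorem1:
  fixes c :: real and K :: nat
  assumes "c > 0" and "K \<ge> 1"
  shows "\<exists>al. is_solution c K al
     \<and> (\<forall>be. is_solution c K be \<longrightarrow> (\<forall>k<K. \<forall>t\<in>{0..1}. be k t = al k t))
     \<and> (\<forall>\<epsilon>>0. (\<lambda>n. measure_pmf.prob (expl_process c K n)
            {xs. \<exists>t\<in>{0..1}. \<exists>k<K. \<bar>alpha_n n xs k t - al k t\<bar> > \<epsilon>}) \<longlonglongrightarrow> 0)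
     \<and> weak_conv_m (\<lambda>n. distr (measure_pmf (threshold_final c K n)) borel
                          (\<lambda>I. real (card I) / real n))
                   (return borel (\<Sum>k<K. al k 1))"
proof -
  obtain al where sol: "is_solution c K al"
    and al: "\<And>k t. k < K \<Longrightarrow> t \<in> {0..1} \<Longrightarrow> ((\<lambda>s. delta1 c K (\<lambda>i. al i s) k) has_integral al k t) {0..t}"
    by (rule is_solution_exists[OF assms]; (assumption | blast))
  have conv: "(\<lambda>n. measure_pmf.prob (expl_process c K n)
      {xs. \<exists>t\<in>{0..1}. \<exists>k<K. \<bar>alpha_n n xs k t - al k t\<bar> > \<epsilon>}) \<longlonglongrightarrow> 0" if "\<epsilon> > 0" for \<epsilon>
    by (rule expl_process_converges[OF assms al that])
  have "weak_conv_m (\<lambda>n. distr (measure_pmf (threshold_final c K n)) borel (\<lambda>I. real (card I) / real n))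
      (return borel (\<Sum>k<K. al k 1))"
  proof (rule weak_conv_m_return)
    fix \<epsilon> :: real assume "\<epsilon> > 0"
    then have "\<epsilon> / K > 0" using assms by simp
    have ev: "eventually (\<lambda>n. measure_pmf.prob (threshold_final c K n) {I. \<bar>real (card I) / n - (\<Sum>k<K. al k 1)\<bar> > \<epsilon>}
      \<le> measure_pmf.prob (expl_process c K n) {xs. \<exists>t\<in>{0..1}. \<exists>k<K. \<bar>alpha_n n xs k t - al k t\<bar> > \<epsilon> / K}) sequentially"
      using eventually_gt_at_top[of 0]
      by eventually_elim (rule threshold_final_deviation[OF assms(2) \<open>\<epsilon> > 0\<close>])
    show "(\<lambda>n. measure_pmf.prob (threshold_final c K n) {I. \<bar>real (card I) / n - (\<Sum>k<K. al k 1)\<bar> > \<epsilon>}) \<longlonglongrightarrow> 0"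
      by (rule tendsto_sandwich[OF always_eventually ev tendsto_const conv[OF \<open>\<epsilon> / K > 0\<close>]]) simp
  qed
  then show ?thesis
    using sol conv is_solution_unique[OF _ sol] by blast
qed

end
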